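(* There exists an absolute constant $C>0$ such that for every $d\ge 1$ and every function $f\colon\{0,1\}^d\to\mathbb{R}$, \[ \mathbb{E}_{\boldsymbol{x}\sim\{0,1\}^d}\Big[\sqrt{I_f^-(\boldsymbol{x})}\Big]\ \ge\ C\cdot\varepsilon(f), \] where $\boldsymbol{x}$ is uniform on $\{0,1\}^d$.
   Context: The directed $d$-dimensional hypercube has vertex set $\{0,1\}^d$ and edges the ordered pairs $(x,y)$ such that there is a unique $i\in[d]$ with $x_i=0$, $y_i=1$, and $x_j=y_j$ for all $j\neq i$. The partial order is $x\preceq y$ iff $x_i\le y_i$ for all $i$. A function $g\colon\{0,1\}^d\to\mathbb{R}$ is monotone if $g(x)\le g(y)$ whenever $x\preceq y$. The distance to monotonicity $\varepsilon(f)$ is the minimum of $\Pr_{\boldsymbol{x}}[f(\boldsymbol{x})\ne g(\boldsymbol{x})]$ over monotone $g\colon\{0,1\}^d\to\mathbb{R}$ ($\boldsymbol{x}$ uniform). An edge $(x,y)$ is violated by $f$ if $f(x)>f(y)$; $\mathcal{S}_f^-$ denotes the set of violated edges, and $I_f^-(x)=|\{y:(x,y)\in\mathcal{S}_f^-\}|$ is the number of outgoing violated edges at $x$. *)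

theory Defs
  imports "HOL-Probability.Probability"
begin

text \<open>
  The dimension is a natural number rather than a type, so that a constant can be chosen
  before it.  A point of \<open>{0,1}^d\<close> is an extensional function on \<open>{1..d}\<close> (it is
  \<open>undefined\<close> outside \<open>{1..d}\<close>), so that distinct elements of \<open>cube d\<close> are distinct points.
  Real functions on the cube are total functions whose values outside \<open>cube d\<close> are never used.
\<close>

definition cube :: "nat \<Rightarrow> (nat \<Rightarrow> nat) set" where
  "cube d = {1..d} \<rightarrow>\<^sub>E {0, 1}"

definition cube_edges :: "nat \<Rightarrow> ((nat \<Rightarrow> nat) \<times> (nat \<Rightarrow> nat)) set" where
  "cube_edges d = {(x, y). x \<in> cube d \<and> y \<in> cube d \<and>
     (\<exists>!i. i \<in> {1..d} \<and> x i = 0 \<and> y i = 1 \<and> (\<forall>j\<in>{1..d}. j \<noteq> i \<longrightarrow> x j = y j))}"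

definition cube_le :: "nat \<Rightarrow> (nat \<Rightarrow> nat) \<Rightarrow> (nat \<Rightarrow> nat) \<Rightarrow> bool" where
  "cube_le d x y \<longleftrightarrow> (\<forall>i\<in>{1..d}. x i \<le> y i)"

definition cube_monotone :: "nat \<Rightarrow> ((nat \<Rightarrow> nat) \<Rightarrow> real) \<Rightarrow> bool" where
  "cube_monotone d g \<longleftrightarrow> monotone_on (cube d) (cube_le d) (\<le>) g"

definition unif_cube :: "nat \<Rightarrow> (nat \<Rightarrow> nat) pmf" where
  "unif_cube d = pmf_of_set (cube d)"

text \<open>
  \<open>Min\<close> is meaningful here: only finitely many probabilities occur, although there are
  infinitely many monotone \<open>g\<close>; see the lemmas below.
\<close>

definition dist_mono :: "nat \<Rightarrow> ((nat \<Rightarrow> nat) \<Rightarrow> real) \<Rightarrow> real" where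
  "dist_mono d f =
     Min {measure_pmf.prob (unif_cube d) {x. f x \<noteq> g x} | g. cube_monotone d g}"

definition violated_edges ::
  "nat \<Rightarrow> ((nat \<Rightarrow> nat) \<Rightarrow> real) \<Rightarrow> ((nat \<Rightarrow> nat) \<times> (nat \<Rightarrow> nat)) set" where
  "violated_edges d f = {(x, y) \<in> cube_edges d. f x > f y}"

definition neg_influence :: "nat \<Rightarrow> ((nat \<Rightarrow> nat) \<Rightarrow> real) \<Rightarrow> (nat \<Rightarrow> nat) \<Rightarrow> nat" where
  "neg_influence d f x = card {y. (x, y) \<in> violated_edges d f}"

lemma finite_cube: "finite (cube d)"
  by (simp add: cube_def finite_PiE)

lemma cube_nonempty: "cube d \<noteq> {}"
  by (simp add: cube_def PiE_eq_empty_iff)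

lemma finite_dist_values:
  "finite {measure_pmf.prob (unif_cube d) {x. f x \<noteq> g x} | g. cube_monotone d g}"
proof (rule finite_subset)
  show "{measure_pmf.prob (unif_cube d) {x. f x \<noteq> g x} | g. cube_monotone d g}
      \<subseteq> (\<lambda>A. real (card A) / real (card (cube d))) ` Pow (cube d)"
    by (auto simp: unif_cube_def measure_pmf_of_set[OF cube_nonempty finite_cube])
qed (simp add: finite_cube)

lemma dist_mono_attained:
  obtains g where "cube_monotone d g"
    and "dist_mono d f = measure_pmf.prob (unif_cube d) {x. f x \<noteq> g x}"
proof -
  have "cube_monotone d (\<lambda>_. 0)"
    by (simp add: cube_monotone_def monotone_on_def)
  then have "{measure_pmf.prob (unif_cube d) {x. f x \<noteq> g x} | g. cube_monotone d g} \<noteq> {}"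
    by blast
  from Min_in[OF finite_dist_values this] show ?thesis
    using that unfolding dist_mono_def by blast
qed

lemma dist_mono_le:
  "cube_monotone d g \<Longrightarrow> dist_mono d f \<le> measure_pmf.prob (unif_cube d) {x. f x \<noteq> g x}"
  unfolding dist_mono_def by (rule Min_le[OF finite_dist_values]) blast

end

theory Submission
  imports Defs "HOL-Library.Transitive_Closure_Table"
begin

text \<open>
  Points of the cube are identified with subsets of a finite set \<open>V\<close>.  For a Boolean \<open>P\<close> and a list
  \<open>\<sigma>\<close> of coordinates, let \<open>G\<^sub>S\<close> be \<open>P\<close> sorted successively along the coordinates of \<open>\<sigma>\<close> that lie in
  \<open>S\<close>.  For fixed \<open>X\<close> the map \<open>S \<mapsto> G\<^sub>S X\<close> is itself a Boolean function on a cube, so Talagrand's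
  one-sided inequality bounds its variance; summed over \<open>X\<close> the boundary terms are at most the
  directed boundary of \<open>P\<close> in the coordinates of \<open>\<sigma>\<close>, because sorting never increases a suitable
  potential.  Hence \<open>G\<^sub>S\<close> is close to some \<open>h\<close> independent of \<open>S\<close>.  As sorting is a contraction and
  is idempotent, sorting \<open>G\<^sub>S\<close> further along the complement \<open>S'\<close> of \<open>S\<close> changes little: the result is close
  to \<open>h\<close> sorted along \<open>S'\<close>, thus to \<open>G\<^sub>S\<^sub>'\<close> sorted along \<open>S'\<close>, which is \<open>G\<^sub>S\<^sub>'\<close> itself.
  So passing from a random half of the coordinates to all of them costs only the directed boundary,
  and since the boundary in a random half is smaller by a factor \<open>1 / sqrt 2\<close>, the costs of repeated
  halving form a geometric series and no logarithm is lost.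

  A real-valued \<open>f\<close> is reduced to Boolean functions with disjointly supported violations.  Match
  points below to points above with maximal total drop of \<open>f\<close>, and subject to that with the fewest
  pairs.  Calling a pair smaller than another if its lower end is below the upper end of the other,
  each strongly connected class of pairs yields one Boolean function, and the intervals spanned by
  different classes are disjoint.
\<close>

section \<open>Talagrand's one-sided inequality\<close>

lemma sum_Pow_insert:
  assumes "finite V" "v \<notin> V"
  shows "(\<Sum>X\<in>Pow (insert v V). g X) = (\<Sum>X\<in>Pow V. g X + g (insert v X))"
proof -
  have "(\<Sum>X\<in>Pow (insert v V). g X) = sum g (Pow V) + sum g (insert v ` Pow V)"
    unfolding Pow_insert using assms by (intro sum.union_disjoint) auto
  also have "sum g (insert v ` Pow V) = (\<Sum>X\<in>Pow V. g (insert v X))"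
    using assms by (subst sum.reindex) (auto simp: inj_on_def insert_ident)
  finally show ?thesis
    by (simp add: sum.distrib)
qed

lemma sum_Pow_remove:
  assumes "finite V" "v \<in> V"
  shows "(\<Sum>X\<in>Pow V. g X) = (\<Sum>X\<in>Pow (V - {v}). g X + g (insert v X))"
  using sum_Pow_insert[of "V - {v}" v g] assms by (simp add: insert_absorb)

lemma sum_Pow_compl:
  "(\<Sum>X\<in>Pow V. g (V - X)) = (\<Sum>X\<in>Pow V. g X)"
  by (rule sum.reindex_bij_witness[of _ "\<lambda>X. V - X" "\<lambda>X. V - X"]) auto

lemma sqrt_sum_squares_le_sum_sqrt:
  fixes u v :: "'a \<Rightarrow> real"
  shows "sqrt ((\<Sum>i\<in>I. u i)\<^sup>2 + (\<Sum>i\<in>I. v i)\<^sup>2) \<le> (\<Sum>i\<in>I. sqrt ((u i)\<^sup>2 + (v i)\<^sup>2))"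
proof -
  have "sqrt ((\<Sum>i\<in>I. u i)\<^sup>2 + (\<Sum>i\<in>I. v i)\<^sup>2) = norm (\<Sum>i\<in>I. Complex (u i) (v i))"
    by (simp add: norm_complex_def)
  also have "\<dots> \<le> (\<Sum>i\<in>I. norm (Complex (u i) (v i)))"
    by (rule norm_sum)
  finally show ?thesis
    by (simp add: norm_complex_def)
qed

definition flip :: "'a \<Rightarrow> 'a set \<Rightarrow> 'a set" where
  "flip i X = (if i \<in> X then X - {i} else insert i X)"

definition vol :: "'a set \<Rightarrow> ('a set \<Rightarrow> bool) \<Rightarrow> real" where
  "vol V P = (\<Sum>X\<in>Pow V. of_bool (P X))"

text \<open>Neighbours in both directions count, upward and downward; "one-sided" refers to summing
  only over points where \<open>P\<close> holds.\<close>

definition out_boundary :: "'a set \<Rightarrow> ('a set \<Rightarrow> bool) \<Rightarrow> real" where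
  "out_boundary V P = (\<Sum>X\<in>Pow V. if P X then sqrt (real (card {i\<in>V. \<not> P (flip i X)})) else 0)"

lemma vol_nonneg: "vol V P \<ge> 0"
  unfolding vol_def by (rule sum_nonneg) auto

lemma vol_le: "finite V \<Longrightarrow> vol V P \<le> 2 ^ card V"
  unfolding vol_def using sum_mono[of "Pow V" "\<lambda>X. of_bool (P X)" "\<lambda>_. 1::real"]
  by (simp add: card_Pow)

lemma vol_diff_le:
  assumes "finite V"
  shows "vol V P - vol V Q \<le> vol V (\<lambda>X. P X \<and> \<not> Q X)"
  unfolding vol_def sum_subtractf[symmetric] by (rule sum_mono) auto

lemma vol_insert:
  assumes "finite V" "v \<notin> V"
  shows "vol (insert v V) P = vol V P + vol V (\<lambda>X. P (insert v X))"
  unfolding vol_def sum_Pow_insert[OF assms] sum.distrib ..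

text \<open>Prepares the induction on the dimension: points split by membership of \<open>v\<close>,
  and the edge between \<open>X\<close> and \<open>insert v X\<close> supplies the
  \<open>of_bool\<close> term at either end.\<close>

lemma out_boundary_insert:
  assumes "finite V" "v \<notin> V"
  shows "out_boundary (insert v V) P =
     (\<Sum>X\<in>Pow V. if P X then sqrt (real (card {i\<in>V. \<not> P (flip i X)}) + of_bool (\<not> P (insert v X))) else 0) +
     (\<Sum>X\<in>Pow V. if P (insert v X) then
        sqrt (real (card {i\<in>V. \<not> P (insert v (flip i X))}) + of_bool (\<not> P X)) else 0)"
proof -
  have "card {i\<in>insert v V. \<not> P (flip i X)} = card {i\<in>V. \<not> P (flip i X)} + of_bool (\<not> P (insert v X))"
    if "X \<in> Pow V" for X
  proof -
    have "{i\<in>insert v V. \<not> P (flip i X)} =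
        (if P (insert v X) then {i\<in>V. \<not> P (flip i X)} else insert v {i\<in>V. \<not> P (flip i X)})"
      using that assms by (auto simp: flip_def)
    then show ?thesis
      using assms by auto
  qed
  moreover have "card {i\<in>insert v V. \<not> P (flip i (insert v X))} =
      card {i\<in>V. \<not> P (insert v (flip i X))} + of_bool (\<not> P X)"
    if "X \<in> Pow V" for X
  proof -
    have *: "flip i (insert v X) = insert v (flip i X)" if "i \<in> V" for i
      using that assms by (auto simp: flip_def)
    have **: "flip v (insert v X) = X"
      using that assms by (auto simp: flip_def)
    have "{i\<in>insert v V. \<not> P (flip i (insert v X))} =
        (if P X then {i\<in>V. \<not> P (insert v (flip i X))} else insert v {i\<in>V. \<not> P (insert v (flip i X))})"
      using assms by (auto simp: * **)
    then show ?thesis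
      using assms by auto
  qed
  ultimately show ?thesis
    unfolding out_boundary_def sum_Pow_insert[OF assms] sum.distrib
    by (intro arg_cong2[where f = "(+)"] sum.cong) auto
qed

text \<open>With N doubled, m (N - m) / N at m0 + m1 exceeds the sum of its values at
  \<open>m0\<close> and \<open>m1\<close> by exactly t^2 / (2 N), where t = m0 - m1. The square root
  with b \<ge> t pays for this excess, because J \<le> N / 4 and t \<le> N.\<close>

lemma isoperimetric_step_real:
  fixes N m0 m1 Q0 Q1 b :: real
  assumes N: "N > 0" and m: "0 \<le> m1" "m1 \<le> m0" "m0 \<le> N"
    and Q: "Q0 \<ge> m0 * (N - m0) / N" "Q1 \<ge> m1 * (N - m1) / N" and b: "b \<ge> m0 - m1"
  shows "(m0 + m1) * (2 * N - (m0 + m1)) / (2 * N) \<le> sqrt (Q0\<^sup>2 + b\<^sup>2) + Q1"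
proof -
  define J where "J = m0 * (N - m0) / N"
  define t where "t = m0 - m1"
  have J0: "J \<ge> 0"
    unfolding J_def using N m by simp
  have J1: "J \<le> N / 4"
  proof -
    have "4 * (m0 * (N - m0)) \<le> N * N"
      using zero_le_power2[of "N - 2 * m0"] by (simp add: power2_eq_square algebra_simps)
    then show ?thesis
      unfolding J_def using N by (simp add: field_simps)
  qed
  have t: "0 \<le> t" "t \<le> N"
    using m by (auto simp: t_def)
  have "(J + t\<^sup>2 / (2 * N))\<^sup>2 \<le> J\<^sup>2 + t\<^sup>2"
  proof -
    have "t\<^sup>2 \<le> N\<^sup>2"
      using t by (intro power_mono) auto
    have "(J + t\<^sup>2 / (2 * N))\<^sup>2 = J\<^sup>2 + t\<^sup>2 * (J / N + t\<^sup>2 / (4 * N\<^sup>2))"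
      using N by (simp add: power2_eq_square field_simps)
    also have "J / N + t\<^sup>2 / (4 * N\<^sup>2) \<le> 1 / 4 + 1 / 4"
      using J1 \<open>t\<^sup>2 \<le> N\<^sup>2\<close> N by (intro add_mono) (auto simp: field_simps)
    then have "t\<^sup>2 * (J / N + t\<^sup>2 / (4 * N\<^sup>2)) \<le> t\<^sup>2 * 1"
      by (intro mult_left_mono) auto
    finally show ?thesis
      by simp
  qed
  also have "\<dots> \<le> Q0\<^sup>2 + b\<^sup>2"
    using Q(1) b J0 t unfolding J_def t_def by (intro add_mono power_mono) auto
  finally have "J + t\<^sup>2 / (2 * N) \<le> sqrt (Q0\<^sup>2 + b\<^sup>2)"
    by (rule real_le_rsqrt)
  moreover have "(m0 + m1) * (2 * N - (m0 + m1)) / (2 * N) = J + t\<^sup>2 / (2 * N) + m1 * (N - m1) / N"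
    unfolding J_def t_def using N by (simp add: power2_eq_square field_simps)
  ultimately show ?thesis
    using Q(2) by linarith
qed

text \<open>
  Only the larger half \<open>P\<close> contributes boundary in the new direction; there Minkowski's inequality
  separates the new direction from the old ones.
\<close>

lemma talagrand_half_step:
  fixes u :: "'a set \<Rightarrow> nat"
  assumes V: "finite V" and le: "vol V Q \<le> vol V P"
    and P: "vol V P * (2 ^ card V - vol V P) / 2 ^ card V \<le> (\<Sum>X\<in>Pow V. if P X then sqrt (real (u X)) else 0)"
    and Q: "vol V Q * (2 ^ card V - vol V Q) / 2 ^ card V \<le> (\<Sum>X\<in>Pow V. if Q X then sqrt (real (w X)) else 0)"
  shows "(vol V P + vol V Q) * (2 * 2 ^ card V - (vol V P + vol V Q)) / (2 * 2 ^ card V)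
    \<le> (\<Sum>X\<in>Pow V. if P X then sqrt (real (u X) + of_bool (\<not> Q X)) else 0)
      + (\<Sum>X\<in>Pow V. if Q X then sqrt (real (w X) + of_bool (\<not> P X)) else 0)"
proof -
  have "(vol V P + vol V Q) * (2 * 2 ^ card V - (vol V P + vol V Q)) / (2 * 2 ^ card V)
     \<le> sqrt ((\<Sum>X\<in>Pow V. if P X then sqrt (real (u X)) else 0)\<^sup>2 + (vol V (\<lambda>X. P X \<and> \<not> Q X))\<^sup>2)
        + (\<Sum>X\<in>Pow V. if Q X then sqrt (real (w X)) else 0)"
    using V le P Q by (intro isoperimetric_step_real) (auto simp: vol_nonneg vol_le vol_diff_le)
  also have "sqrt ((\<Sum>X\<in>Pow V. if P X then sqrt (real (u X)) else 0)\<^sup>2 + (vol V (\<lambda>X. P X \<and> \<not> Q X))\<^sup>2)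
     \<le> (\<Sum>X\<in>Pow V. sqrt ((if P X then sqrt (real (u X)) else 0)\<^sup>2 + (of_bool (P X \<and> \<not> Q X))\<^sup>2))"
    unfolding vol_def by (rule sqrt_sum_squares_le_sum_sqrt)
  also have "\<dots> = (\<Sum>X\<in>Pow V. if P X then sqrt (real (u X) + of_bool (\<not> Q X)) else 0)"
    by (intro sum.cong) auto
  also have "(\<Sum>X\<in>Pow V. if Q X then sqrt (real (w X)) else 0) \<le>
      (\<Sum>X\<in>Pow V. if Q X then sqrt (real (w X) + of_bool (\<not> P X)) else 0)"
    by (intro sum_mono) auto
  finally show ?thesis
    by simp
qed

text \<open>The left side is the variance of \<open>P\<close> times the number of points. In the
  induction, the half of larger volume takes the role of \<open>P\<close> in
  \<open>talagrand_half_step\<close>.\<close>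

theorem talagrand_one_sided:
  assumes "finite V"
  shows "vol V P * (2 ^ card V - vol V P) / 2 ^ card V \<le> out_boundary V P"
  using assms
proof (induction V arbitrary: P rule: finite_induct)
  case empty
  have "vol {} P = of_bool (P {})"
    by (simp only: vol_def Pow_empty sum.insert sum.empty finite.emptyI empty_iff add_0_right not_False_eq_True)
  moreover have "out_boundary {} P \<ge> 0"
    unfolding out_boundary_def by (rule sum_nonneg) auto
  ultimately show ?case
    by (cases "P {}") simp_all
next
  case (insert v V)
  let ?P = "\<lambda>X. P (insert v X)"
  have card: "2 ^ card (insert v V) = (2 * 2 ^ card V :: real)"
    using insert by simp
  have IH0: "vol V P * (2 ^ card V - vol V P) / 2 ^ card V
      \<le> (\<Sum>X\<in>Pow V. if P X then sqrt (real (card {i\<in>V. \<not> P (flip i X)})) else 0)"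
    using insert.IH[of P] by (simp add: out_boundary_def)
  have IH1: "vol V ?P * (2 ^ card V - vol V ?P) / 2 ^ card V
      \<le> (\<Sum>X\<in>Pow V. if ?P X then sqrt (real (card {i\<in>V. \<not> ?P (flip i X)})) else 0)"
    using insert.IH[of ?P] by (simp add: out_boundary_def)
  show ?case
  proof (cases "vol V ?P \<le> vol V P")
    case True
    from talagrand_half_step[OF insert.hyps(1) True IH0 IH1] show ?thesis
      unfolding card vol_insert[OF insert.hyps] out_boundary_insert[OF insert.hyps] .
  next
    case False
    then have "vol V P \<le> vol V ?P"
      by simp
    from talagrand_half_step[OF insert.hyps(1) this IH1 IH0] show ?thesis
      unfolding card vol_insert[OF insert.hyps] out_boundary_insert[OF insert.hyps]
      by (simp add: add.commute)
  qed
qed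

section \<open>Sorting along coordinates\<close>

text \<open>Only upward edges count: for \<open>j \<in> X\<close> the point
  \<open>insert j X\<close> is \<open>X\<close> itself. The set \<open>J\<close> of directions
  varies in the recursion over random subsets of coordinates.\<close>

definition neg_boundary :: "'a set \<Rightarrow> 'a set \<Rightarrow> ('a set \<Rightarrow> bool) \<Rightarrow> real" where
  "neg_boundary V J P = (\<Sum>X\<in>Pow V. if P X then sqrt (real (card {j\<in>J. \<not> P (insert j X)})) else 0)"

definition hamming :: "'a set \<Rightarrow> ('a set \<Rightarrow> bool) \<Rightarrow> ('a set \<Rightarrow> bool) \<Rightarrow> real" where
  "hamming V P Q = (\<Sum>X\<in>Pow V. of_bool (P X \<noteq> Q X))"

text \<open>Exchanges the two values on an edge in direction \<open>i\<close> exactly when that edge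
  is violated.\<close>

definition coord_sort :: "'a \<Rightarrow> ('a set \<Rightarrow> bool) \<Rightarrow> 'a set \<Rightarrow> bool" where
  "coord_sort i P X \<longleftrightarrow> (if i \<in> X then P X \<or> P (X - {i}) else P X \<and> P (insert i X))"

definition coord_mono :: "'a \<Rightarrow> ('a set \<Rightarrow> bool) \<Rightarrow> bool" where
  "coord_mono i P \<longleftrightarrow> (\<forall>X. P X \<longrightarrow> P (insert i X))"

abbreviation sort_list :: "'a list \<Rightarrow> ('a set \<Rightarrow> bool) \<Rightarrow> 'a set \<Rightarrow> bool" where
  "sort_list \<equiv> fold coord_sort"

definition sort_on :: "'a list \<Rightarrow> ('a set \<Rightarrow> bool) \<Rightarrow> 'a set \<Rightarrow> 'a set \<Rightarrow> bool" where
  "sort_on \<sigma> P S = sort_list (filter (\<lambda>i. i \<in> S) \<sigma>) P"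

lemma coord_mono_coord_sort_same: "coord_mono i (coord_sort i P)"
  by (auto simp: coord_mono_def coord_sort_def insert_absorb)

text \<open>Minimum and maximum along \<open>j\<close> preserve monotonicity in \<open>i\<close>, so
  a direction once sorted stays sorted.\<close>

lemma coord_mono_coord_sort:
  assumes "coord_mono i P"
  shows "coord_mono i (coord_sort j P)"
proof (cases "i = j")
  case True
  then show ?thesis
    by (simp add: coord_mono_coord_sort_same)
next
  case False
  then have "insert i X - {j} = insert i (X - {j})" for X
    by auto
  then show ?thesis
    using assms False by (auto simp: coord_mono_def coord_sort_def insert_commute[of j i])
qed

lemma coord_mono_sort_list:
  "coord_mono i P \<or> i \<in> set \<sigma> \<Longrightarrow> coord_mono i (sort_list \<sigma> P)"
  by (induction \<sigma> arbitrary: P) (auto simp: coord_mono_coord_sort coord_mono_coord_sort_same)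

lemma coord_sort_idem:
  assumes "coord_mono i P"
  shows "coord_sort i P = P"
proof
  fix X
  show "coord_sort i P X = P X"
    using assms unfolding coord_mono_def coord_sort_def
    by (metis insert_Diff)
qed

lemma sort_list_idem:
  "(\<And>i. i \<in> set \<sigma> \<Longrightarrow> coord_mono i P) \<Longrightarrow> sort_list \<sigma> P = P"
  by (induction \<sigma>) (auto simp: coord_sort_idem)

lemma hamming_sym: "hamming V P Q = hamming V Q P"
  unfolding hamming_def by (intro sum.cong) auto

lemma hamming_triangle: "hamming V P Q \<le> hamming V P R + hamming V R Q"
  unfolding hamming_def sum.distrib[symmetric] by (rule sum_mono) auto

text \<open>Checked edge by edge: putting two pairs of bits in increasing order cannot create
  additional disagreements.\<close>

lemma hamming_coord_sort_le:
  assumes "finite V" "i \<in> V"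
  shows "hamming V (coord_sort i P) (coord_sort i Q) \<le> hamming V P Q"
  unfolding hamming_def sum_Pow_remove[OF assms]
proof (rule sum_mono)
  fix X assume "X \<in> Pow (V - {i})"
  then have "i \<notin> X"
    by auto
  then show "of_bool (coord_sort i P X \<noteq> coord_sort i Q X) +
      of_bool (coord_sort i P (insert i X) \<noteq> coord_sort i Q (insert i X))
      \<le> (of_bool (P X \<noteq> Q X) + of_bool (P (insert i X) \<noteq> Q (insert i X)) :: real)"
    by (auto simp: coord_sort_def)
qed

lemma hamming_sort_list_le:
  "finite V \<Longrightarrow> set \<sigma> \<subseteq> V \<Longrightarrow> hamming V (sort_list \<sigma> P) (sort_list \<sigma> Q) \<le> hamming V P Q"
proof (induction \<sigma> arbitrary: P Q)
  case (Cons i \<sigma>)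
  then have "hamming V (sort_list \<sigma> (coord_sort i P)) (sort_list \<sigma> (coord_sort i Q)) \<le>
      hamming V (coord_sort i P) (coord_sort i Q)"
    by simp
  also have "\<dots> \<le> hamming V P Q"
    using Cons.prems by (intro hamming_coord_sort_le) auto
  finally show ?case
    by simp
qed simp

section \<open>Boundary of the family of sorted functions in its index\<close>

lemma sqrt_add_le_of_majorized:
  fixes a b p q :: real
  assumes "p + q = a + b" "0 \<le> q" "q \<le> a" "q \<le> b"
  shows "sqrt p + sqrt q \<le> sqrt a + sqrt b"
proof -
  \<comment> \<open>Since the sums agree, comparing squares reduces the claim to
    \<open>p * q \<le> a * b\<close>.\<close>
  have "0 \<le> (a - q) * (b - q)"
    using assms by simp
  also have "\<dots> = a * b - q * (a + b - q)"
    by (simp add: algebra_simps)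
  also have "a + b - q = p"
    using assms by simp
  finally have "sqrt (p * q) \<le> sqrt (a * b)"
    by (simp add: mult.commute)
  moreover have "0 \<le> p"
    using assms by simp
  ultimately have "(sqrt p + sqrt q)\<^sup>2 \<le> (sqrt a + sqrt b)\<^sup>2"
    using assms by (simp add: power2_sum real_sqrt_mult)
  then show ?thesis
    by (rule power2_le_imp_le) (use assms in auto)
qed

lemma sqrt_card_Un_Int_le:
  assumes "finite A" "finite B"
  shows "sqrt (card (A \<union> B)) + sqrt (card (A \<inter> B)) \<le> sqrt (card A) + sqrt (card B)"
proof (rule sqrt_add_le_of_majorized)
  show "real (card (A \<union> B)) + real (card (A \<inter> B)) = real (card A) + real (card B)"
    using card_Un_Int[OF assms] by linarith
qed (use assms in \<open>auto intro: card_mono\<close>)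

text \<open>
  On a line where \<open>F\<close> is constantly true, the sets of failing indices at the two ends are replaced by
  their union and intersection, which is where the concavity of \<open>sqrt\<close> enters.
\<close>

lemma coord_sort_boundary_le:
  assumes V: "finite V" "i \<in> V" and K: "finite K"
  shows "(\<Sum>X\<in>Pow V. if coord_sort i F X
        then sqrt (real (card {k\<in>K. \<not> coord_sort i (A k) X}) + of_bool (\<not> F X)) else 0)
    \<le> (\<Sum>X\<in>Pow V. if F X
        then sqrt (real (card {k\<in>K. \<not> A k X}) + of_bool (\<not> F (insert i X))) else 0)"
  unfolding sum_Pow_remove[OF V]
proof (rule sum_mono)
  fix X assume "X \<in> Pow (V - {i})"
  then have i: "i \<notin> X" "insert i X - {i} = X"
    by auto
  let ?c = "{k\<in>K. \<not> A k X}" and ?c' = "{k\<in>K. \<not> A k (insert i X)}"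
  have Un: "{k\<in>K. \<not> coord_sort i (A k) X} = ?c \<union> ?c'"
    using i by (auto simp: coord_sort_def)
  have Int: "{k\<in>K. \<not> coord_sort i (A k) (insert i X)} = ?c \<inter> ?c'"
    using i by (auto simp: coord_sort_def)
  have "card (?c \<inter> ?c') \<le> card ?c" "card (?c \<inter> ?c') \<le> card ?c'"
    using K by (auto intro: card_mono)
  moreover have "sqrt (card (?c \<union> ?c')) + sqrt (card (?c \<inter> ?c')) \<le> sqrt (card ?c) + sqrt (card ?c')"
    using K by (intro sqrt_card_Un_Int_le) auto
  ultimately show "(if coord_sort i F X
        then sqrt (real (card {k\<in>K. \<not> coord_sort i (A k) X}) + of_bool (\<not> F X)) else 0) +
      (if coord_sort i F (insert i X)
        then sqrt (real (card {k\<in>K. \<not> coord_sort i (A k) (insert i X)}) + of_bool (\<not> F (insert i X))) else 0)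
    \<le> (if F X then sqrt (real (card ?c) + of_bool (\<not> F (insert i X))) else 0) +
      (if F (insert i X) then sqrt (real (card ?c') + of_bool (\<not> F (insert i (insert i X)))) else 0)"
    unfolding Un Int using i by (auto simp: coord_sort_def)
qed

lemma sort_on_snoc:
  "sort_on (\<sigma> @ [i]) P S = (if i \<in> S then coord_sort i (sort_on \<sigma> P S) else sort_on \<sigma> P S)"
  by (simp add: sort_on_def)

lemma sort_on_flip:
  assumes "i \<notin> set \<sigma>"
  shows "sort_on \<sigma> P (flip i S) = sort_on \<sigma> P S"
proof -
  have "filter (\<lambda>j. j \<in> flip i S) \<sigma> = filter (\<lambda>j. j \<in> S) \<sigma>"
    using assms by (intro filter_cong) (auto simp: flip_def)
  then show ?thesis
    by (simp add: sort_on_def)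
qed

lemma coord_sort_insert:
  assumes "i \<noteq> k"
  shows "coord_sort i (\<lambda>X. F (insert k X)) X = coord_sort i F (insert k X)"
proof -
  have "insert k X - {i} = insert k (X - {i})"
    using assms by auto
  then show ?thesis
    using assms by (simp add: coord_sort_def insert_commute)
qed

lemma card_remove_of_bool:
  assumes "finite K" "i \<in> K"
  shows "card {k\<in>K. Q k} = card {k\<in>K - {i}. Q k} + of_bool (Q i)"
proof -
  have "{k\<in>K. Q k} = (if Q i then insert i {k\<in>K - {i}. Q k} else {k\<in>K - {i}. Q k})"
    using assms by auto
  then show ?thesis
    using assms by auto
qed

text \<open>
  Interpolates between the two boundaries in the course of sorting: coordinates already treated are
  flipped in the index \<open>S\<close>, the remaining ones are raised in the point \<open>X\<close>.
\<close>

definition neighbour_value ::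
    "'a list \<Rightarrow> ('a set \<Rightarrow> bool) \<Rightarrow> 'a set \<Rightarrow> 'a \<Rightarrow> 'a set \<Rightarrow> bool" where
  "neighbour_value \<sigma> P S k X =
     (if k \<in> set \<sigma> then sort_on \<sigma> P (flip k S) X else sort_on \<sigma> P S (insert k X))"

lemma neighbour_value_snoc:
  assumes "k \<noteq> i"
  shows "neighbour_value (\<sigma> @ [i]) P S k =
    (if i \<in> S then coord_sort i (neighbour_value \<sigma> P S k) else neighbour_value \<sigma> P S k)"
proof -
  have "i \<in> flip k S \<longleftrightarrow> i \<in> S"
    using assms by (auto simp: flip_def)
  then show ?thesis
    using assms coord_sort_insert[of i k "sort_on \<sigma> P S"]
    by (cases "k \<in> set \<sigma>") (auto simp: neighbour_value_def[abs_def] sort_on_snoc fun_eq_iff)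
qed

text \<open>Treating a new \<open>i\<close> replaces raising \<open>X\<close> by flipping the index
  in that direction. If \<open>i \<in> S\<close>, the function is sorted along \<open>i\<close>, its
  flipped neighbour is the unsorted \<open>?F\<close>, and \<open>coord_sort_boundary_le\<close>
  applies. If \<open>i \<notin> S\<close>, the function and the other neighbours stay as they
  are.\<close>

lemma sort_on_boundary_le_aux:
  assumes "finite V" "K \<subseteq> V" "distinct \<sigma>" "set \<sigma> \<subseteq> K"
  shows "(\<Sum>X\<in>Pow V. if sort_on \<sigma> P S X
      then sqrt (real (card {k\<in>K. \<not> neighbour_value \<sigma> P S k X})) else 0) \<le> neg_boundary V K P"
  using assms(3,4)
proof (induction \<sigma> rule: rev_induct)
  case Nil
  have *: "neighbour_value [] P S k X = P (insert k X)" "sort_on [] P S = P" for k X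
    by (simp_all add: neighbour_value_def sort_on_def)
  show ?case
    unfolding * neg_boundary_def by (rule order_refl)
next
  case (snoc i \<sigma>)
  have i: "i \<in> K" "i \<notin> set \<sigma>"
    using snoc.prems by auto
  have K: "finite K"
    using assms(1,2) by (rule finite_subset[rotated])
  let ?F = "sort_on \<sigma> P S" and ?A = "neighbour_value \<sigma> P S" and ?A' = "neighbour_value (\<sigma> @ [i]) P S"
  have card: "card {k\<in>K. \<not> ?A k X} = card {k\<in>K - {i}. \<not> ?A k X} + of_bool (\<not> ?F (insert i X))" for X
    using card_remove_of_bool[OF K i(1), of "\<lambda>k. \<not> ?A k X"] i by (simp add: neighbour_value_def)
  have Ai: "?A' i = (if i \<in> S then ?F else coord_sort i ?F)"
    using i by (auto simp: neighbour_value_def[abs_def] sort_on_snoc sort_on_flip fun_eq_iff)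
      (auto simp: flip_def)
  have card': "card {k\<in>K. \<not> ?A' k X} = card {k\<in>K - {i}. \<not> ?A' k X} + of_bool (\<not> ?A' i X)" for X
    using card_remove_of_bool[OF K i(1)] .
  have "(\<Sum>X\<in>Pow V. if sort_on (\<sigma> @ [i]) P S X then sqrt (real (card {k\<in>K. \<not> ?A' k X})) else 0)
     \<le> (\<Sum>X\<in>Pow V. if ?F X then sqrt (real (card {k\<in>K. \<not> ?A k X})) else 0)"
  proof (cases "i \<in> S")
    case True
    have *: "{k\<in>K - {i}. \<not> ?A' k X} = {k\<in>K - {i}. \<not> coord_sort i (?A k) X}" for X
      using True by (auto simp: neighbour_value_snoc)
    have "(\<Sum>X\<in>Pow V. if sort_on (\<sigma> @ [i]) P S X then sqrt (real (card {k\<in>K. \<not> ?A' k X})) else 0)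
      = (\<Sum>X\<in>Pow V. if coord_sort i ?F X
        then sqrt (real (card {k\<in>K - {i}. \<not> coord_sort i (?A k) X}) + of_bool (\<not> ?F X)) else 0)"
      unfolding card' Ai * using True by (simp add: sort_on_snoc cong: if_cong)
    also have "\<dots> \<le> (\<Sum>X\<in>Pow V. if ?F X
        then sqrt (real (card {k\<in>K - {i}. \<not> ?A k X}) + of_bool (\<not> ?F (insert i X))) else 0)"
      using assms i K by (intro coord_sort_boundary_le) auto
    finally show ?thesis
      unfolding card by (simp cong: if_cong)
  next
    case False
    have "{k\<in>K - {i}. \<not> ?A' k X} = {k\<in>K - {i}. \<not> ?A k X}" for X
      using False by (auto simp: neighbour_value_snoc)
    \<comment> \<open>Where \<open>?F\<close> holds, sorting along \<open>i\<close> yields the value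
      at the raised point, so no term of the sum changes.\<close>
    moreover have "coord_sort i ?F X \<longleftrightarrow> ?F (insert i X)" if "?F X" for X
      using that by (auto simp: coord_sort_def insert_absorb)
    ultimately show ?thesis
      using False unfolding card' card Ai by (intro sum_mono) (auto simp: sort_on_snoc)
  qed
  also have "\<dots> \<le> neg_boundary V K P"
    using snoc by simp
  finally show ?case .
qed

text \<open>Once all of \<open>\<sigma>\<close> is treated, every neighbour is a flip of the index,
  and the summand at \<open>X\<close> is that of \<open>out_boundary\<close> for the map from
  \<open>S\<close> to \<open>sort_on \<sigma> P S X\<close>.\<close>

lemma sort_on_boundary_le:
  assumes "finite V" "distinct \<sigma>" "set \<sigma> \<subseteq> V"
  shows "(\<Sum>X\<in>Pow V. if sort_on \<sigma> P S X
      then sqrt (real (card {i\<in>set \<sigma>. \<not> sort_on \<sigma> P (flip i S) X})) else 0) \<le> neg_boundary V (set \<sigma>) P"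
proof -
  have *: "{i\<in>set \<sigma>. \<not> sort_on \<sigma> P (flip i S) X} = {k\<in>set \<sigma>. \<not> neighbour_value \<sigma> P S k X}" for X
    by (auto simp: neighbour_value_def)
  show ?thesis
    unfolding * by (rule sort_on_boundary_le_aux[OF assms(1,3,2) subset_refl])
qed

text \<open>Talagrand's inequality works in the variable \<open>S\<close> for each \<open>X\<close>,
  the boundary bound sums over \<open>X\<close> for each \<open>S\<close>; exchanging the sums joins
  them.\<close>

lemma sum_vol_sort_on_le:
  fixes P :: "'a set \<Rightarrow> bool"
  assumes "finite V" "distinct \<sigma>" "set \<sigma> \<subseteq> V"
  defines "N \<equiv> 2 ^ length \<sigma>" and "m \<equiv> \<lambda>X. vol (set \<sigma>) (\<lambda>S. sort_on \<sigma> P S X)"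
  shows "(\<Sum>X\<in>Pow V. m X * (N - m X) / N) \<le> N * neg_boundary V (set \<sigma>) P"
proof -
  have N: "N = 2 ^ card (set \<sigma>)"
    unfolding N_def using assms by (simp add: distinct_card)
  have "(\<Sum>X\<in>Pow V. m X * (N - m X) / N) \<le> (\<Sum>X\<in>Pow V. out_boundary (set \<sigma>) (\<lambda>S. sort_on \<sigma> P S X))"
    unfolding m_def N by (intro sum_mono talagrand_one_sided) auto
  also have "\<dots> = (\<Sum>S\<in>Pow (set \<sigma>). \<Sum>X\<in>Pow V. if sort_on \<sigma> P S X
      then sqrt (real (card {i\<in>set \<sigma>. \<not> sort_on \<sigma> P (flip i S) X})) else 0)"
    unfolding out_boundary_def by (rule sum.swap)
  also have "\<dots> \<le> (\<Sum>S\<in>Pow (set \<sigma>). neg_boundary V (set \<sigma>) P)"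
    using assms by (intro sum_mono sort_on_boundary_le) auto
  also have "\<dots> = N * neg_boundary V (set \<sigma>) P"
    by (simp add: N card_Pow)
  finally show ?thesis .
qed

text \<open>\<open>h\<close> is the majority value over all \<open>S\<close>. The minority has
  min(m, N - m) members, at most 2 m (N - m) / N because the majority has at least N / 2.\<close>

lemma sum_hamming_sort_on_le:
  assumes "finite V" "distinct \<sigma>" "set \<sigma> \<subseteq> V"
  obtains h where "(\<Sum>S\<in>Pow (set \<sigma>). hamming V (sort_on \<sigma> P S) h) \<le> 2 * 2 ^ length \<sigma> * neg_boundary V (set \<sigma>) P"
proof
  define N :: real where "N = 2 ^ length \<sigma>"
  define m where "m = (\<lambda>X. vol (set \<sigma>) (\<lambda>S. sort_on \<sigma> P S X))"
  define h where "h = (\<lambda>X. 2 * m X \<ge> N)"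
  have N: "N = 2 ^ card (set \<sigma>)" "N > 0"
    unfolding N_def using assms by (simp_all add: distinct_card)
  have m: "0 \<le> m X" "m X \<le> N" for X
    unfolding m_def N by (auto simp: vol_nonneg vol_le)
  have "(\<Sum>S\<in>Pow (set \<sigma>). of_bool (sort_on \<sigma> P S X \<noteq> h X)) \<le> 2 * (m X * (N - m X) / N)" for X
  proof (cases "h X")
    case True
    have "(\<Sum>S\<in>Pow (set \<sigma>). of_bool (sort_on \<sigma> P S X \<noteq> h X)) =
        (\<Sum>S\<in>Pow (set \<sigma>). 1 - of_bool (sort_on \<sigma> P S X) :: real)"
      using True by (intro sum.cong) auto
    also have "\<dots> = N - m X"
      unfolding sum_subtractf m_def vol_def N by (simp add: card_Pow del: sum_of_bool_eq)
    also have "\<dots> * N \<le> (N - m X) * (2 * m X)"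
      using True m[of X] by (intro mult_left_mono) (auto simp: h_def)
    then have "N - m X \<le> 2 * (m X * (N - m X) / N)"
      using N by (simp add: field_simps)
    finally show ?thesis .
  next
    case False
    have "(\<Sum>S\<in>Pow (set \<sigma>). of_bool (sort_on \<sigma> P S X \<noteq> h X)) = m X"
      unfolding m_def vol_def using False by simp
    also have "m X * N \<le> m X * (2 * (N - m X))"
      using False m[of X] by (intro mult_left_mono) (auto simp: h_def)
    then have "m X \<le> 2 * (m X * (N - m X) / N)"
      using N by (simp add: field_simps)
    finally show ?thesis .
  qed
  then have "(\<Sum>X\<in>Pow V. \<Sum>S\<in>Pow (set \<sigma>). of_bool (sort_on \<sigma> P S X \<noteq> h X))
      \<le> (\<Sum>X\<in>Pow V. 2 * (m X * (N - m X) / N))"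
    by (intro sum_mono) auto
  also have "\<dots> \<le> 2 * (N * neg_boundary V (set \<sigma>) P)"
    unfolding sum_distrib_left[symmetric]
    using sum_vol_sort_on_le[OF assms(1,2,3), of P] unfolding N_def m_def by simp
  finally show "(\<Sum>S\<in>Pow (set \<sigma>). hamming V (sort_on \<sigma> P S) h)
      \<le> 2 * 2 ^ length \<sigma> * neg_boundary V (set \<sigma>) P"
    unfolding hamming_def N_def by (subst sum.swap) simp
qed

section \<open>Distance to monotonicity of Boolean functions\<close>

text \<open>The distances of \<open>A\<close> and \<open>B\<close> to \<open>h\<close> each occur
  twice, once directly and once through the contraction along \<open>\<beta>\<close>.
  Complementation permutes the sets \<open>S\<close>, so four equal sums arise, each with constant
  2: hence the 8.\<close>

lemma sum_hamming_sort_split_le: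
  assumes V: "finite V" and \<sigma>: "distinct \<sigma>" "set \<sigma> \<subseteq> V"
  shows "(\<Sum>S\<in>Pow (set \<sigma>). hamming V (sort_list (filter (\<lambda>i. i \<in> S) \<sigma> @ filter (\<lambda>i. i \<notin> S) \<sigma>) P) P)
    \<le> (\<Sum>S\<in>Pow (set \<sigma>). hamming V (sort_list (filter (\<lambda>i. i \<in> S) \<sigma>) P) P)
       + 8 * 2 ^ length \<sigma> * neg_boundary V (set \<sigma>) P"
proof -
  obtain h where h: "(\<Sum>S\<in>Pow (set \<sigma>). hamming V (sort_on \<sigma> P S) h)
      \<le> 2 * 2 ^ length \<sigma> * neg_boundary V (set \<sigma>) P"
    using sum_hamming_sort_on_le[OF assms] by blast
  have "hamming V (sort_list (filter (\<lambda>i. i \<in> S) \<sigma> @ filter (\<lambda>i. i \<notin> S) \<sigma>) P) P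
      \<le> hamming V (sort_on \<sigma> P S) P + 2 * hamming V (sort_on \<sigma> P S) h
        + 2 * hamming V (sort_on \<sigma> P (set \<sigma> - S)) h" for S
  proof -
    define A where "A = sort_on \<sigma> P S"
    define B where "B = sort_on \<sigma> P (set \<sigma> - S)"
    define \<beta> where "\<beta> = filter (\<lambda>i. i \<notin> S) \<sigma>"
    have B: "B = sort_list \<beta> P"
      unfolding B_def \<beta>_def sort_on_def by (metis (mono_tags, lifting) Diff_iff filter_cong)
    \<comment> \<open>\<open>B\<close> results from sorting along \<open>\<beta>\<close>, hence is
      already monotone in those directions.\<close>
    have idem: "sort_list \<beta> B = B"
      unfolding B by (rule sort_list_idem) (auto intro: coord_mono_sort_list)
    have \<beta>: "set \<beta> \<subseteq> V"
      using \<sigma> by (auto simp: \<beta>_def)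
    have "sort_list (filter (\<lambda>i. i \<in> S) \<sigma> @ \<beta>) P = sort_list \<beta> A"
      by (simp add: A_def sort_on_def)
    moreover have "hamming V (sort_list \<beta> A) P \<le> hamming V (sort_list \<beta> A) A + hamming V A P"
      by (rule hamming_triangle)
    moreover have "hamming V (sort_list \<beta> A) A \<le> hamming V (sort_list \<beta> A) B + hamming V B A"
      by (rule hamming_triangle)
    moreover have "hamming V (sort_list \<beta> A) B \<le> hamming V (sort_list \<beta> A) (sort_list \<beta> h) + hamming V (sort_list \<beta> h) (sort_list \<beta> B)"
      using hamming_triangle[of V "sort_list \<beta> A" B "sort_list \<beta> h"] unfolding idem .
    moreover have "hamming V (sort_list \<beta> A) (sort_list \<beta> h) \<le> hamming V A h"
      using V \<beta> by (rule hamming_sort_list_le)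
    moreover have "hamming V (sort_list \<beta> h) (sort_list \<beta> B) \<le> hamming V h B"
      using V \<beta> by (rule hamming_sort_list_le)
    moreover have "hamming V B A \<le> hamming V B h + hamming V h A"
      by (rule hamming_triangle)
    ultimately show ?thesis
      unfolding A_def[symmetric] B_def[symmetric] \<beta>_def[symmetric]
      using hamming_sym[of V h B] hamming_sym[of V h A] by simp
  qed
  then have "(\<Sum>S\<in>Pow (set \<sigma>). hamming V (sort_list (filter (\<lambda>i. i \<in> S) \<sigma> @ filter (\<lambda>i. i \<notin> S) \<sigma>) P) P)
     \<le> (\<Sum>S\<in>Pow (set \<sigma>). hamming V (sort_on \<sigma> P S) P + 2 * hamming V (sort_on \<sigma> P S) h
        + 2 * hamming V (sort_on \<sigma> P (set \<sigma> - S)) h)"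
    by (rule sum_mono)
  also have "\<dots> = (\<Sum>S\<in>Pow (set \<sigma>). hamming V (sort_on \<sigma> P S) P)
      + 4 * (\<Sum>S\<in>Pow (set \<sigma>). hamming V (sort_on \<sigma> P S) h)"
    using sum_Pow_compl[of "\<lambda>S. hamming V (sort_on \<sigma> P S) h" "set \<sigma>"]
    by (simp add: sum.distrib sum_distrib_left[symmetric])
  also have "\<dots> \<le> (\<Sum>S\<in>Pow (set \<sigma>). hamming V (sort_on \<sigma> P S) P)
      + 8 * 2 ^ length \<sigma> * neg_boundary V (set \<sigma>) P"
    using h by linarith
  finally show ?thesis
    by (simp add: sort_on_def)
qed

section \<open>Random orders and random halves of the coordinates\<close>

lemma pair_pmf_of_set:
  assumes "finite A" "A \<noteq> {}" "finite B" "B \<noteq> {}"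
  shows "pair_pmf (pmf_of_set A) (pmf_of_set B) = pmf_of_set (A \<times> B)"
  by (rule pmf_eqI, clarify) (use assms in \<open>simp add: pmf_pair card_cartesian_product indicator_def\<close>)

lemma set_minus_take:
  assumes "distinct xs"
  shows "set xs - set (take n xs) = set (drop n xs)"
proof -
  have "set xs = set (take n xs) \<union> set (drop n xs)"
    by (metis append_take_drop_id set_append)
  then show ?thesis
    using set_take_disj_set_drop_if_distinct[OF assms order_refl, of n] by blast
qed

definition perm_avg :: "('a list \<Rightarrow> real) \<Rightarrow> 'a set \<Rightarrow> real" where
  "perm_avg W R = (\<Sum>\<sigma>\<in>permutations_of_set R. W \<sigma>) / fact (card R)"

text \<open>In a uniformly random order of \<open>R\<close>, the induced orders of \<open>S\<close>
  and \<open>R - S\<close> are independent and uniform.\<close>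

lemma perm_avg_partition:
  assumes R: "finite R" and S: "S \<subseteq> R"
  shows "perm_avg (\<lambda>\<sigma>. g (filter (\<lambda>i. i \<in> S) \<sigma>) (filter (\<lambda>i. i \<notin> S) \<sigma>)) R =
     perm_avg (\<lambda>\<alpha>. perm_avg (\<lambda>\<beta>. g \<alpha> \<beta>) (R - S)) S"
proof -
  have fin: "finite S" "finite (R - S)"
    using assms finite_subset by auto
  have eq: "{x\<in>R. x \<in> S} = S" "{x\<in>R. x \<notin> S} = R - S"
    using S by auto
  have ne: "permutations_of_set A \<noteq> {}" if "finite A" for A :: "'a set"
    using that by simp
  have "perm_avg (\<lambda>\<sigma>. g (filter (\<lambda>i. i \<in> S) \<sigma>) (filter (\<lambda>i. i \<notin> S) \<sigma>)) R =
     measure_pmf.expectation (map_pmf (partition (\<lambda>i. i \<in> S)) (pmf_of_set (permutations_of_set R))) (\<lambda>(\<alpha>, \<beta>). g \<alpha> \<beta>)"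
    using R by (simp add: perm_avg_def integral_pmf_of_set o_def)
  also have "\<dots> = measure_pmf.expectation (pair_pmf (pmf_of_set (permutations_of_set S))
      (pmf_of_set (permutations_of_set (R - S)))) (\<lambda>(\<alpha>, \<beta>). g \<alpha> \<beta>)"
    unfolding partition_random_permutations[OF R] eq ..
  also have "pair_pmf (pmf_of_set (permutations_of_set S)) (pmf_of_set (permutations_of_set (R - S))) =
      pmf_of_set (permutations_of_set S \<times> permutations_of_set (R - S))"
    using fin by (intro pair_pmf_of_set) auto
  also have "measure_pmf.expectation \<dots> (\<lambda>(\<alpha>, \<beta>). g \<alpha> \<beta>) =
      (\<Sum>(\<alpha>, \<beta>)\<in>permutations_of_set S \<times> permutations_of_set (R - S). g \<alpha> \<beta>) / (fact (card S) * fact (card (R - S)))"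
    using fin by (subst integral_pmf_of_set) (auto simp: card_cartesian_product)
  also have "\<dots> = perm_avg (\<lambda>\<alpha>. perm_avg (\<lambda>\<beta>. g \<alpha> \<beta>) (R - S)) S"
    unfolding perm_avg_def sum.cartesian_product[symmetric]
    by (simp add: sum_divide_distrib field_simps)
  finally show ?thesis .
qed

lemma perm_avg_const: "finite R \<Longrightarrow> perm_avg (\<lambda>_. c) R = c"
  by (simp add: perm_avg_def)

lemma perm_avg_filter:
  assumes "finite R" "S \<subseteq> R"
  shows "perm_avg (\<lambda>\<sigma>. W (filter (\<lambda>i. i \<in> S) \<sigma>)) R = perm_avg W S"
  using perm_avg_partition[OF assms, of "\<lambda>\<alpha> \<beta>. W \<alpha>"] assms by (simp add: perm_avg_const)

lemma sum_inverse_fact: "(\<Sum>s\<le>n. 1 / (fact s * fact (n - s))) = (2 ^ n / fact n :: real)"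
proof -
  have "(\<Sum>s\<le>n. 1 / (fact s * fact (n - s))) = (\<Sum>s\<le>n. real (n choose s) / fact n :: real)"
    by (intro sum.cong) (auto simp: binomial_fact)
  also have "\<dots> = real (\<Sum>s\<le>n. n choose s) / fact n"
    by (simp add: sum_divide_distrib)
  finally show ?thesis
    by (simp add: choose_row_sum)
qed

text \<open>Each order of \<open>R\<close> arises as a concatenation once per cut position s, with a
  weight 1 / (s! (n - s)!) depending on s alone. Thus a random \<open>S\<close> followed by its
  complement amounts, on average, to a uniformly random order.\<close>

lemma sum_perm_avg_split:
  assumes R: "finite R"
  shows "(\<Sum>S\<in>Pow R. perm_avg (\<lambda>\<sigma>. W (filter (\<lambda>i. i \<in> S) \<sigma> @ filter (\<lambda>i. i \<notin> S) \<sigma>)) R)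
     = 2 ^ card R * perm_avg W R"
proof -
  have length_le: "length xs \<le> card R" if "set xs \<subseteq> R" "distinct xs" for xs
    using that R by (metis card_mono distinct_card)
  let ?c = "\<lambda>s. 1 / (fact s * fact (card R - s)) :: real"
  have "(\<Sum>S\<in>Pow R. perm_avg (\<lambda>\<sigma>. W (filter (\<lambda>i. i \<in> S) \<sigma> @ filter (\<lambda>i. i \<notin> S) \<sigma>)) R)
      = (\<Sum>S\<in>Pow R. perm_avg (\<lambda>\<alpha>. perm_avg (\<lambda>\<beta>. W (\<alpha> @ \<beta>)) (R - S)) S)"
    using R by (intro sum.cong perm_avg_partition) auto
  also have "\<dots> = (\<Sum>S\<in>Pow R. \<Sum>(\<alpha>, \<beta>)\<in>permutations_of_set S \<times> permutations_of_set (R - S). ?c (card S) * W (\<alpha> @ \<beta>))"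
    using R by (intro sum.cong refl)
      (auto simp: perm_avg_def sum.cartesian_product[symmetric] sum_divide_distrib card_Diff_subset finite_subset field_simps)
  also have "\<dots> = (\<Sum>(S, \<alpha>, \<beta>)\<in>(SIGMA S:Pow R. permutations_of_set S \<times> permutations_of_set (R - S)). ?c (card S) * W (\<alpha> @ \<beta>))"
    using R by (subst sum.Sigma) (auto intro: finite_cartesian_product)
  also have "\<dots> = (\<Sum>(\<tau>, s)\<in>permutations_of_set R \<times> {..card R}. ?c s * W \<tau>)"
    by (rule sum.reindex_bij_witness[of _ "\<lambda>(\<tau>, s). (set (take s \<tau>), take s \<tau>, drop s \<tau>)"
          "\<lambda>(S, \<alpha>, \<beta>). (\<alpha> @ \<beta>, card S)"])
      (use R length_le in \<open>auto simp: permutations_of_set_def distinct_card set_minus_take[symmetric]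
         dest: in_set_takeD in_set_dropD\<close>)
  also have "\<dots> = (\<Sum>\<tau>\<in>permutations_of_set R. (\<Sum>s\<le>card R. ?c s) * W \<tau>)"
    by (simp add: sum.cartesian_product[symmetric] sum_distrib_right)
  also have "\<dots> = 2 ^ card R * perm_avg W R"
    unfolding sum_inverse_fact perm_avg_def by (simp add: sum_distrib_left sum_divide_distrib)
  finally show ?thesis .
qed

text \<open>Pair \<open>S\<close> with its complement: the two cardinalities add up to
  \<open>card A\<close>, and sqrt x + sqrt y \<le> sqrt (2 (x + y)).\<close>

lemma sum_sqrt_card_Int_le:
  assumes R: "finite R" and A: "A \<subseteq> R"
  shows "(\<Sum>S\<in>Pow R. sqrt (card (A \<inter> S))) \<le> 2 ^ card R * sqrt (card A) / sqrt 2"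
proof -
  have fin: "finite A"
    using assms finite_subset by auto
  have "sqrt (card (A \<inter> S)) + sqrt (card (A \<inter> (R - S))) \<le> sqrt 2 * sqrt (card A)" if "S \<in> Pow R" for S
  proof -
    have "A = (A \<inter> S) \<union> (A \<inter> (R - S))"
      using A by auto
    then have "card A = card (A \<inter> S) + card (A \<inter> (R - S))"
      using fin by (metis (no_types, lifting) Diff_disjoint card_Un_disjoint finite_Int inf_assoc inf_bot_right inf_left_commute)
    moreover have "(sqrt x + sqrt y)\<^sup>2 \<le> 2 * (x + y)" if "x \<ge> 0" "y \<ge> 0" for x y :: real
      using zero_le_power2[of "sqrt x - sqrt y"] that by (simp add: power2_sum power2_diff)
    ultimately have "(sqrt (card (A \<inter> S)) + sqrt (card (A \<inter> (R - S))))\<^sup>2 \<le> 2 * real (card A)"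
      by (metis of_nat_0_le_iff of_nat_add)
    then show ?thesis
      unfolding real_sqrt_mult[symmetric] by (rule real_le_rsqrt)
  qed
  then have "(\<Sum>S\<in>Pow R. sqrt (card (A \<inter> S)) + sqrt (card (A \<inter> (R - S)))) \<le> (\<Sum>S\<in>Pow R. sqrt 2 * sqrt (card A))"
    by (rule sum_mono)
  then have "2 * (\<Sum>S\<in>Pow R. sqrt (card (A \<inter> S))) \<le> 2 ^ card R * (sqrt 2 * sqrt (card A))"
    using sum_Pow_compl[of "\<lambda>S. sqrt (card (A \<inter> S))" R] R by (simp add: sum.distrib card_Pow)
  also have "\<dots> = 2 * (2 ^ card R * sqrt (card A) / sqrt 2)"
    by (simp add: field_simps)
  finally show ?thesis
    by simp
qed

lemma sum_neg_boundary_le: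
  assumes R: "finite R"
  shows "(\<Sum>S\<in>Pow R. neg_boundary V S P) \<le> 2 ^ card R * neg_boundary V R P / sqrt 2"
proof -
  let ?A = "\<lambda>X. {j\<in>R. \<not> P (insert j X)}"
  have "(\<Sum>S\<in>Pow R. neg_boundary V S P) = (\<Sum>S\<in>Pow R. \<Sum>X\<in>Pow V. if P X then sqrt (card (?A X \<inter> S)) else 0)"
    unfolding neg_boundary_def
  proof (intro sum.cong refl)
    fix S X assume "S \<in> Pow R"
    then have "{j\<in>S. \<not> P (insert j X)} = ?A X \<inter> S"
      by auto
    then show "(if P X then sqrt (card {j\<in>S. \<not> P (insert j X)}) else 0) = (if P X then sqrt (card (?A X \<inter> S)) else 0)"
      by simp
  qed
  also have "\<dots> = (\<Sum>X\<in>Pow V. \<Sum>S\<in>Pow R. if P X then sqrt (card (?A X \<inter> S)) else 0)"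
    by (rule sum.swap)
  also have "\<dots> = (\<Sum>X\<in>Pow V. if P X then \<Sum>S\<in>Pow R. sqrt (card (?A X \<inter> S)) else 0)"
    by (intro sum.cong refl) auto
  also have "\<dots> \<le> (\<Sum>X\<in>Pow V. if P X then 2 ^ card R * sqrt (card (?A X)) / sqrt 2 else 0)"
    by (intro sum_mono) (use sum_sqrt_card_Int_le[OF R] in auto)
  also have "\<dots> = 2 ^ card R * neg_boundary V R P / sqrt 2"
    unfolding neg_boundary_def sum_distrib_left sum_divide_distrib by (intro sum.cong refl) auto
  finally show ?thesis .
qed

lemma neg_boundary_nonneg: "neg_boundary V R P \<ge> 0"
  unfolding neg_boundary_def by (rule sum_nonneg) auto

text \<open>
  Averaging over the order of the coordinates makes the splitting inequality a recursion in \<open>R\<close> alone.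
  The constant only has to satisfy \<open>28 / sqrt 2 + 8 \<le> 28\<close>.
\<close>

lemma perm_avg_hamming_le:
  assumes V: "finite V" and "R \<subseteq> V"
  shows "perm_avg (\<lambda>\<sigma>. hamming V (sort_list \<sigma> P) P) R \<le> 28 * neg_boundary V R P"
proof -
  have "finite R"
    using assms finite_subset by auto
  then show ?thesis
    using assms(2)
  proof (induction R rule: finite_psubset_induct)
    case (psubset R)
    define W where "W = (\<lambda>\<sigma>. hamming V (sort_list \<sigma> P) P)"
    define N :: real where "N = 2 ^ card R"
    define T where "T = neg_boundary V R P"
    have T: "T \<ge> 0"
      by (simp add: T_def neg_boundary_nonneg)
    show ?case
    proof (cases "R = {}")
      case True
      then show ?thesis
        using neg_boundary_nonneg[of V R P] by (simp add: perm_avg_def hamming_def)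
    next
      case False
      have N: "N > 1"
        using False psubset.hyps by (simp add: N_def card_gt_0_iff one_less_power)
      have "N * perm_avg W R = (\<Sum>S\<in>Pow R. perm_avg (\<lambda>\<sigma>. W (filter (\<lambda>i. i \<in> S) \<sigma> @ filter (\<lambda>i. i \<notin> S) \<sigma>)) R)"
        using psubset.hyps by (simp add: sum_perm_avg_split N_def)
      also have "\<dots> = perm_avg (\<lambda>\<sigma>. \<Sum>S\<in>Pow R. W (filter (\<lambda>i. i \<in> S) \<sigma> @ filter (\<lambda>i. i \<notin> S) \<sigma>)) R"
        unfolding perm_avg_def sum_divide_distrib[symmetric] by (subst sum.swap) simp
      also have "\<dots> \<le> perm_avg (\<lambda>\<sigma>. (\<Sum>S\<in>Pow R. W (filter (\<lambda>i. i \<in> S) \<sigma>)) + 8 * N * T) R"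
        unfolding perm_avg_def
      proof (intro divide_right_mono sum_mono)
        fix \<sigma> assume "\<sigma> \<in> permutations_of_set R"
        then have \<sigma>: "distinct \<sigma>" "set \<sigma> = R" "length \<sigma> = card R"
          by (auto simp: permutations_of_set_def distinct_card)
        show "(\<Sum>S\<in>Pow R. W (filter (\<lambda>i. i \<in> S) \<sigma> @ filter (\<lambda>i. i \<notin> S) \<sigma>))
            \<le> (\<Sum>S\<in>Pow R. W (filter (\<lambda>i. i \<in> S) \<sigma>)) + 8 * N * T"
          using sum_hamming_sort_split_le[OF V \<sigma>(1), of P] psubset.prems
          unfolding \<sigma>(2,3) W_def T_def N_def by simp
      qed auto
      also have "\<dots> = (\<Sum>S\<in>Pow R. perm_avg (\<lambda>\<sigma>. W (filter (\<lambda>i. i \<in> S) \<sigma>)) R) + 8 * N * T"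
        using perm_avg_const[OF psubset.hyps(1), of "8 * N * T"]
        unfolding perm_avg_def sum.distrib add_divide_distrib sum_divide_distrib[symmetric]
        by (subst (2) sum.swap) simp
      also have "(\<Sum>S\<in>Pow R. perm_avg (\<lambda>\<sigma>. W (filter (\<lambda>i. i \<in> S) \<sigma>)) R) = (\<Sum>S\<in>Pow R. perm_avg W S)"
        using psubset.hyps by (intro sum.cong refl perm_avg_filter) auto
      \<comment> \<open>The term \<open>S = R\<close> is the unknown itself. It has weight 1 against
        \<open>N\<close> and moves to the left at the end, leaving the factor
        \<open>N - 1\<close>.\<close>
      also have "\<dots> = perm_avg W R + (\<Sum>S\<in>Pow R - {R}. perm_avg W S)"
        using psubset.hyps by (simp add: sum.remove)
      also have "(\<Sum>S\<in>Pow R - {R}. perm_avg W S) \<le> (\<Sum>S\<in>Pow R - {R}. 28 * neg_boundary V S P)"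
        unfolding W_def using psubset.prems by (intro sum_mono psubset.IH) auto
      also have "\<dots> = 28 * ((\<Sum>S\<in>Pow R. neg_boundary V S P) - T)"
        using psubset.hyps by (simp add: sum_distrib_left[symmetric] sum_diff1 T_def)
      also have "\<dots> \<le> 28 * (N * T / sqrt 2 - T)"
        using sum_neg_boundary_le[OF psubset.hyps(1), of V P] by (simp add: N_def T_def)
      also have "\<dots> \<le> 20 * N * T - 28 * T"
      proof -
        \<comment> \<open>784 \<le> 800. The 20 gained here and the 8 from splitting add up to
          28.\<close>
        have "28 \<le> 20 * sqrt 2"
          by (rule power2_le_imp_le) (auto simp: power_mult_distrib)
        then have "28 * (N * T) \<le> (20 * sqrt 2) * (N * T)"
          using N T by (intro mult_right_mono) auto
        then show ?thesis
          by (simp add: field_simps)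
      qed
      finally have "(N - 1) * perm_avg W R \<le> (N - 1) * (28 * T)"
        by (simp add: algebra_simps)
      then show ?thesis
        using N unfolding W_def T_def by simp
    qed
  qed
qed

text \<open>Some order does no worse than the average, and sorting along all of it gives
  monotonicity in every direction.\<close>

lemma exists_mono_hamming_le:
  assumes V: "finite V"
  obtains Q where "\<And>i. i \<in> V \<Longrightarrow> coord_mono i Q" "hamming V Q P \<le> 28 * neg_boundary V V P"
proof -
  have "\<exists>\<sigma>\<in>permutations_of_set V. hamming V (sort_list \<sigma> P) P \<le> 28 * neg_boundary V V P"
  proof (rule ccontr)
    assume "\<not> ?thesis"
    then have "(\<Sum>\<sigma>\<in>permutations_of_set V. 28 * neg_boundary V V P) <
        (\<Sum>\<sigma>\<in>permutations_of_set V. hamming V (sort_list \<sigma> P) P)"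
      using V by (intro sum_strict_mono) auto
    then have "28 * neg_boundary V V P < perm_avg (\<lambda>\<sigma>. hamming V (sort_list \<sigma> P) P) V"
      using V by (simp add: perm_avg_def field_simps)
    with perm_avg_hamming_le[OF V subset_refl, of P] show False
      by simp
  qed
  then obtain \<sigma> where "set \<sigma> = V" "hamming V (sort_list \<sigma> P) P \<le> 28 * neg_boundary V V P"
    by (auto simp: permutations_of_set_def)
  then show ?thesis
    using that[of "sort_list \<sigma> P"] by (auto intro: coord_mono_sort_list)
qed

section \<open>Reduction of real-valued functions to Boolean ones\<close>

definition matching :: "'a set \<Rightarrow> 'a set set \<Rightarrow> 'a set set \<Rightarrow> ('a set \<Rightarrow> 'a set) \<Rightarrow> bool" where
  "matching V A B \<phi> \<longleftrightarrow>
     A \<subseteq> Pow V \<and> B \<subseteq> Pow V \<and> A \<inter> B = {} \<and> bij_betw \<phi> A B \<and> (\<forall>X\<in>A. X \<subseteq> \<phi> X)"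

text \<open>The total drop depends on \<open>A\<close> and \<open>B\<close> only, so rearranging
  partners does not change it.\<close>

definition optimal_matching ::
    "'a set \<Rightarrow> ('a set \<Rightarrow> real) \<Rightarrow> 'a set set \<Rightarrow> 'a set set \<Rightarrow> ('a set \<Rightarrow> 'a set) \<Rightarrow> bool" where
  "optimal_matching V f A B \<phi> \<longleftrightarrow> matching V A B \<phi> \<and>
     (\<forall>A' B' \<phi>'. matching V A' B' \<phi>' \<longrightarrow>
        sum f A' - sum f B' \<le> sum f A - sum f B \<and>
        (sum f A' - sum f B' = sum f A - sum f B \<longrightarrow> card A \<le> card A'))"

text \<open>The inclusion says that \<open>X\<close> could take over the partner of
  \<open>Y\<close>; paths of this relation encode exchanges of partners.\<close>

definition match_le :: "'a set set \<Rightarrow> ('a set \<Rightarrow> 'a set) \<Rightarrow> 'a set \<Rightarrow> 'a set \<Rightarrow> bool" where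
  "match_le A \<phi> X Y \<longleftrightarrow> X \<in> A \<and> Y \<in> A \<and> X \<subseteq> \<phi> Y"

definition match_class :: "'a set set \<Rightarrow> ('a set \<Rightarrow> 'a set) \<Rightarrow> 'a set \<Rightarrow> 'a set set" where
  "match_class A \<phi> X = {Y \<in> A. (match_le A \<phi>)\<^sup>*\<^sup>* X Y \<and> (match_le A \<phi>)\<^sup>*\<^sup>* Y X}"

definition class_span :: "('a set \<Rightarrow> 'a set) \<Rightarrow> 'a set set \<Rightarrow> 'a set set" where
  "class_span \<phi> C = {Z. \<exists>X\<in>C. \<exists>Y\<in>C. X \<subseteq> Z \<and> Z \<subseteq> \<phi> Y}"

text \<open>Inside the span, \<open>f Z\<close> is compared with the largest value of
  \<open>f\<close> at upper ends of the class above \<open>Z\<close>. This threshold can only fall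
  as \<open>Z\<close> grows, so violations there are violations of \<open>f\<close>. The values
  outside exclude violations on leaving the span.\<close>

definition class_indicator ::
    "('a set \<Rightarrow> real) \<Rightarrow> ('a set \<Rightarrow> 'a set) \<Rightarrow> 'a set set \<Rightarrow> 'a set \<Rightarrow> bool" where
  "class_indicator f \<phi> C Z \<longleftrightarrow>
     (if Z \<in> class_span \<phi> C then \<forall>Y\<in>C. Z \<subseteq> \<phi> Y \<longrightarrow> f (\<phi> Y) < f Z else \<exists>X\<in>C. X \<subseteq> Z)"

definition viol :: "'a set \<Rightarrow> ('a set \<Rightarrow> real) \<Rightarrow> 'a set \<Rightarrow> nat" where
  "viol V f X = card {j\<in>V. f (insert j X) < f X}"

section \<open>Exchange arguments for optimal matchings\<close>

lemma bij_betw_remove: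
  assumes "bij_betw f A B" "x \<in> A"
  shows "bij_betw f (A - {x}) (B - {f x})"
  using assms by (auto simp: bij_betw_def inj_on_def)

lemma bij_betw_fun_upd:
  assumes "bij_betw f A B" "x \<notin> A" "y \<notin> B"
  shows "bij_betw (f(x := y)) (insert x A) (insert y B)"
  using assms by (auto simp: bij_betw_def inj_on_def)

lemma matching_finite: "finite V \<Longrightarrow> matching V A B \<phi> \<Longrightarrow> finite A \<and> finite B"
  unfolding matching_def by (meson finite_Pow_iff finite_subset)

text \<open>Maximizing over pairs \<open>(A, B)\<close> instead of maps \<open>\<phi>\<close> leaves
  finitely many candidates; among the maximizers \<open>card A\<close> is then minimized.\<close>

lemma exists_optimal_matching:
  assumes "finite V"
  obtains A B \<phi> where "optimal_matching V f A B \<phi>"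
proof -
  define M where "M = {(A, B). \<exists>\<phi>. matching V A B \<phi>}"
  define w where "w = (\<lambda>(A, B). sum f A - sum f B)"
  have "M \<subseteq> Pow (Pow V) \<times> Pow (Pow V)"
    by (auto simp: M_def matching_def)
  then have fin: "finite M"
    by (rule finite_subset) (use assms in auto)
  have "({}, {}) \<in> M"
    by (auto simp: M_def matching_def)
  with fin have "Max (w ` M) \<in> w ` M"
    by (intro Max_in) auto
  then obtain p where "p \<in> M \<and> w p = Max (w ` M)"
    by auto
  from ex_has_least_nat[of "\<lambda>p. p \<in> M \<and> w p = Max (w ` M)", OF this, of "\<lambda>p. card (fst p)"]
  obtain A B where AB: "(A, B) \<in> M" "w (A, B) = Max (w ` M)"
    and least: "\<And>q. q \<in> M \<Longrightarrow> w q = Max (w ` M) \<Longrightarrow> card A \<le> card (fst q)"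
    by (metis fst_conv surj_pair)
  from AB(1) obtain \<phi> where \<phi>: "matching V A B \<phi>"
    by (auto simp: M_def)
  have "w q \<le> w (A, B)" if "q \<in> M" for q
    using that fin unfolding AB(2) by simp
  then have "optimal_matching V f A B \<phi>"
    using \<phi> least unfolding optimal_matching_def AB(2)[symmetric] by (force simp: M_def w_def)
  then show ?thesis
    using that by blast
qed

text \<open>Each point of the path takes the partner of its successor. The last clause serves the
  induction: a newly prepended point still has its old partner, which the next exchange
  frees.\<close>

lemma match_path_shift:
  assumes "matching V A B \<phi>"
    and "rtrancl_path (match_le A \<phi>) X Xs Y" "distinct (X # Xs)" "X \<in> A"
  shows "\<exists>\<psi>. bij_betw \<psi> (A - {Y}) (B - {\<phi> X}) \<and> (\<forall>Z\<in>A - {Y}. Z \<subseteq> \<psi> Z) \<and>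
    (\<forall>Z. Z \<notin> set (X # Xs) \<longrightarrow> \<psi> Z = \<phi> Z)"
  using assms(2-)
proof (induction rule: rtrancl_path.induct)
  case (base X)
  with assms(1) show ?case
    by (intro exI[of _ \<phi>]) (auto simp: matching_def intro: bij_betw_remove)
next
  case (step X X' Xs Y)
  then have X': "X' \<in> A" "X \<subseteq> \<phi> X'"
    by (auto simp: match_le_def)
  with step obtain \<psi> where \<psi>: "bij_betw \<psi> (A - {Y}) (B - {\<phi> X'})" "\<forall>Z\<in>A - {Y}. Z \<subseteq> \<psi> Z"
    "\<forall>Z. Z \<notin> set (X' # Xs) \<longrightarrow> \<psi> Z = \<phi> Z"
    by auto
  have inj: "inj_on \<phi> A" and B: "B = \<phi> ` A"
    using assms(1) by (auto simp: matching_def bij_betw_def)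
  have "Y \<in> set (X' # Xs)"
  proof (cases "Xs = []")
    case True
    with step.hyps(2) show ?thesis
      by (auto elim: rtrancl_path.cases)
  next
    case False
    with rtrancl_path_last[OF step.hyps(2)] show ?thesis
      using last_in_set by fastforce
  qed
  then have XY: "X \<noteq> Y" "X \<noteq> X'" and \<psi>X: "\<psi> X = \<phi> X"
    using step.prems \<psi>(3) by auto
  have "\<phi> X \<noteq> \<phi> X'"
    using inj XY X' step.prems by (auto dest: inj_onD)
  have "bij_betw \<psi> (A - {Y} - {X}) (B - {\<phi> X'} - {\<psi> X})"
    using \<psi>(1) XY step.prems by (intro bij_betw_remove) auto
  then have "bij_betw (\<psi>(X := \<phi> X')) (insert X (A - {Y} - {X})) (insert (\<phi> X') (B - {\<phi> X'} - {\<phi> X}))"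
    unfolding \<psi>X by (rule bij_betw_fun_upd) auto
  moreover have "insert X (A - {Y} - {X}) = A - {Y}"
    using XY step.prems by auto
  moreover have "insert (\<phi> X') (B - {\<phi> X'} - {\<phi> X}) = B - {\<phi> X}"
    using X' B \<open>\<phi> X \<noteq> \<phi> X'\<close> by auto
  ultimately have bij: "bij_betw (\<psi>(X := \<phi> X')) (A - {Y}) (B - {\<phi> X})"
    by simp
  have sub: "\<forall>Z\<in>A - {Y}. Z \<subseteq> (\<psi>(X := \<phi> X')) Z"
    using \<psi>(2) X'(2) by simp
  have eq: "\<forall>Z. Z \<notin> set (X # X' # Xs) \<longrightarrow> (\<psi>(X := \<phi> X')) Z = \<phi> Z"
    using \<psi>(3) by simp
  from bij sub eq show ?case
    by (intro exI conjI)
qed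

text \<open>
  Shifting the partners along the path frees \<open>Y\<close> and \<open>\<phi> X\<close>; if \<open>f Y \<le> f (\<phi> X)\<close>, this would be a
  matching with one pair less and no smaller drop.
\<close>

lemma optimal_matching_less:
  assumes V: "finite V" and opt: "optimal_matching V f A B \<phi>"
    and path: "(match_le A \<phi>)\<^sup>*\<^sup>* X Y" and A: "X \<in> A" "Y \<in> A" and le: "Y \<subseteq> \<phi> X"
  shows "f (\<phi> X) < f Y"
proof -
  have m: "matching V A B \<phi>"
    using opt by (simp add: optimal_matching_def)
  note fin = matching_finite[OF V m]
  have "\<phi> X \<in> B"
    using m A by (auto simp: matching_def bij_betw_def)
  obtain Xs where "rtrancl_path (match_le A \<phi>) X Xs Y"
    using path by (auto simp: rtranclp_eq_rtrancl_path)
  then obtain Xs' where "rtrancl_path (match_le A \<phi>) X Xs' Y" "distinct (X # Xs')"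
    by (rule rtrancl_path_distinct)
  from match_path_shift[OF m this A(1)] obtain \<psi> where
    "bij_betw \<psi> (A - {Y}) (B - {\<phi> X})" "\<forall>Z\<in>A - {Y}. Z \<subseteq> \<psi> Z"
    by blast
  then have "matching V (A - {Y}) (B - {\<phi> X}) \<psi>"
    using m by (auto simp: matching_def)
  moreover have "card (A - {Y}) < card A"
    using A fin by (intro card_Diff1_less) auto
  ultimately have "sum f (A - {Y}) - sum f (B - {\<phi> X}) < sum f A - sum f B"
    using opt unfolding optimal_matching_def by (meson le_less not_less)
  then show ?thesis
    using fin A \<open>\<phi> X \<in> B\<close> by (simp add: sum_diff1)
qed

text \<open>A violated pair of unmatched points could be added to the matching and would raise its
  drop.\<close>

lemma optimal_matching_covers:
  assumes V: "finite V" and opt: "optimal_matching V f A B \<phi>"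
    and XY: "X \<subseteq> Y" "Y \<subseteq> V" "X \<notin> A \<union> B" "Y \<notin> A \<union> B"
  shows "f X \<le> f Y"
proof (rule ccontr)
  assume "\<not> ?thesis"
  then have less: "f Y < f X" and "X \<noteq> Y"
    by auto
  have m: "matching V A B \<phi>"
    using opt by (simp add: optimal_matching_def)
  note fin = matching_finite[OF V m]
  have "bij_betw (\<phi>(X := Y)) (insert X A) (insert Y B)"
    using m XY by (intro bij_betw_fun_upd) (auto simp: matching_def)
  then have "matching V (insert X A) (insert Y B) (\<phi>(X := Y))"
    using m XY \<open>X \<noteq> Y\<close> by (auto simp: matching_def)
  then have "sum f (insert X A) - sum f (insert Y B) \<le> sum f A - sum f B"
    using opt unfolding optimal_matching_def by blast
  then show False
    using fin XY less by simp
qed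

text \<open>A common point \<open>Z\<close> lies above a lower end and below an upper end of both
  classes, so each class reaches the other.\<close>

lemma class_span_disjoint:
  assumes X: "X \<in> A" "X' \<in> A"
    and Z: "Z \<in> class_span \<phi> (match_class A \<phi> X)" "Z \<in> class_span \<phi> (match_class A \<phi> X')"
  shows "match_class A \<phi> X = match_class A \<phi> X'"
proof -
  let ?r = "match_le A \<phi>"
  from Z obtain S T S' T' where S: "S \<in> match_class A \<phi> X" "T \<in> match_class A \<phi> X" "S \<subseteq> Z" "Z \<subseteq> \<phi> T"
    and S': "S' \<in> match_class A \<phi> X'" "T' \<in> match_class A \<phi> X'" "S' \<subseteq> Z" "Z \<subseteq> \<phi> T'"
    unfolding class_span_def by blast
  then have "?r S T'" "?r S' T"
    by (auto simp: match_le_def match_class_def)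
  then have "?r\<^sup>*\<^sup>* X X'" "?r\<^sup>*\<^sup>* X' X"
    using S S' unfolding match_class_def
    by (auto intro: rtranclp_trans rtranclp.rtrancl_into_rtrancl)
  then show ?thesis
    unfolding match_class_def by (auto intro: rtranclp_trans)
qed

text \<open>If the indicator falls from \<open>X\<close> in the span to \<open>insert j X\<close>,
  the latter is still in the span, and some \<open>Y\<close> gives f (insert j X) \<le> f (\<phi> Y)
  < f X. From a true point outside nothing falls, because raising it cannot re-enter the
  span.\<close>

lemma neg_boundary_class_indicator_le:
  assumes V: "finite V"
  shows "neg_boundary V V (class_indicator f \<phi> C) \<le> (\<Sum>X\<in>Pow V \<inter> class_span \<phi> C. sqrt (viol V f X))"
proof -
  let ?g = "class_indicator f \<phi> C"
  have inside: "{j\<in>V. \<not> ?g (insert j X)} \<subseteq> {j\<in>V. f (insert j X) < f X}" if "?g X" "X \<in> class_span \<phi> C" for X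
  proof safe
    fix j assume "\<not> ?g (insert j X)"
    moreover from that(2) have "\<exists>S\<in>C. S \<subseteq> insert j X"
      by (auto simp: class_span_def)
    ultimately have "\<exists>Y\<in>C. insert j X \<subseteq> \<phi> Y \<and> f (insert j X) \<le> f (\<phi> Y)"
      by (auto simp: class_indicator_def not_less split: if_splits)
    then show "f (insert j X) < f X"
      using that by (auto simp: class_indicator_def intro: le_less_trans)
  qed
  have outside: "{j\<in>V. \<not> ?g (insert j X)} = {}" if "?g X" "X \<notin> class_span \<phi> C" for X
  proof -
    from that obtain S where S: "S \<in> C" "S \<subseteq> X"
      by (auto simp: class_indicator_def)
    have "insert j X \<notin> class_span \<phi> C" for j
      using S that(2) unfolding class_span_def by blast
    with S show ?thesis
      by (auto simp: class_indicator_def)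
  qed
  have "neg_boundary V V ?g \<le> (\<Sum>X\<in>Pow V. if X \<in> class_span \<phi> C then sqrt (viol V f X) else 0)"
    unfolding neg_boundary_def
  proof (rule sum_mono)
    fix X
    show "(if ?g X then sqrt (card {j\<in>V. \<not> ?g (insert j X)}) else 0)
      \<le> (if X \<in> class_span \<phi> C then sqrt (viol V f X) else 0)"
    proof (cases "?g X")
      case True
      show ?thesis
      proof (cases "X \<in> class_span \<phi> C")
        case True
        with inside[OF \<open>?g X\<close> this] V have "card {j\<in>V. \<not> ?g (insert j X)} \<le> viol V f X"
          unfolding viol_def by (intro card_mono) auto
        with True show ?thesis
          by simp
      next
        case False
        show ?thesis
          unfolding outside[OF \<open>?g X\<close> False] using False by simp
      qed
    qed simp
  qed
  also have "\<dots> = (\<Sum>X\<in>Pow V \<inter> class_span \<phi> C. sqrt (viol V f X))"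
    using V by (simp add: sum.inter_restrict)
  finally show ?thesis .
qed

text \<open>The indicator is true at \<open>S\<close> and false at \<open>\<phi> S\<close>, so a
  monotone \<open>Q\<close> errs at one of them. As pairs are disjoint, there are at least as many
  errors as pairs.\<close>

lemma card_match_class_le:
  assumes V: "finite V" and opt: "optimal_matching V f A B \<phi>" and X: "X \<in> A"
  shows "real (card (match_class A \<phi> X))
    \<le> 28 * (\<Sum>Z\<in>Pow V \<inter> class_span \<phi> (match_class A \<phi> X). sqrt (viol V f Z))"
proof -
  let ?C = "match_class A \<phi> X"
  let ?g = "class_indicator f \<phi> ?C"
  have m: "matching V A B \<phi>"
    using opt by (simp add: optimal_matching_def)
  have AB: "A \<subseteq> Pow V" "B = \<phi> ` A" "B \<subseteq> Pow V" "A \<inter> B = {}" "inj_on \<phi> A" "\<And>S. S \<in> A \<Longrightarrow> S \<subseteq> \<phi> S"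
    using m by (auto simp: matching_def bij_betw_def)
  have C: "?C \<subseteq> A"
    by (auto simp: match_class_def)
  have less: "f (\<phi> T) < f S" if "S \<in> ?C" "T \<in> ?C" "S \<subseteq> \<phi> T" for S T
    using that by (intro optimal_matching_less[OF V opt]) (auto simp: match_class_def intro: rtranclp_trans)
  have span: "S \<in> class_span \<phi> ?C" "\<phi> S \<in> class_span \<phi> ?C" if "S \<in> ?C" for S
    using that AB(6) C unfolding class_span_def by blast+
  have g: "?g S" "\<not> ?g (\<phi> S)" if "S \<in> ?C" for S
    using that less span by (auto simp: class_indicator_def)
  obtain Q where Q: "\<And>i. i \<in> V \<Longrightarrow> coord_mono i Q" "hamming V Q ?g \<le> 28 * neg_boundary V V ?g"
    using exists_mono_hamming_le[OF V] by blast
  have mono: "Q S \<Longrightarrow> Q (S \<union> T)" if "finite T" "T \<subseteq> V" for S T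
    using that by (induction T rule: finite_induct) (use Q(1) in \<open>auto simp: coord_mono_def\<close>)
  \<comment> \<open>Selects an end where \<open>Q\<close> errs: if \<open>Q S\<close> holds, then so
    does \<open>Q (\<phi> S)\<close>, against the indicator.\<close>
  define \<theta> where "\<theta> = (\<lambda>S. if Q S then \<phi> S else S)"
  have "\<theta> ` ?C \<subseteq> {Z\<in>Pow V. Q Z \<noteq> ?g Z}"
  proof (rule image_subsetI)
    fix S assume S: "S \<in> ?C"
    then have "S \<in> A" "\<phi> S \<in> B"
      using AB(2) C by auto
    then have sub: "S \<subseteq> \<phi> S" "\<phi> S \<subseteq> V"
      using AB(3,6) by auto
    have "Q (\<phi> S)" if "Q S"
      using mono[of "\<phi> S" S] that sub V finite_subset by (auto simp: Un_absorb1)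
    then have "Q (\<theta> S) \<noteq> ?g (\<theta> S)"
      using g[OF S] by (cases "Q S") (simp_all add: \<theta>_def)
    moreover have "\<theta> S \<subseteq> V"
      using sub by (auto simp: \<theta>_def split: if_splits)
    ultimately show "\<theta> S \<in> {Z\<in>Pow V. Q Z \<noteq> ?g Z}"
      by simp
  qed
  moreover have "inj_on \<theta> ?C"
  proof (rule inj_onI)
    fix S T assume "S \<in> ?C" "T \<in> ?C" and eq: "\<theta> S = \<theta> T"
    then have ST: "S \<in> A" "T \<in> A"
      using C by auto
    then have "\<phi> S \<notin> A" "\<phi> T \<notin> A"
      using AB(2,4) by auto
    then have "S \<noteq> \<phi> T" "\<phi> S \<noteq> T"
      using ST by metis+
    with eq have "S = T \<or> \<phi> S = \<phi> T"
      by (simp add: \<theta>_def split: if_splits)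
    then show "S = T"
      using ST AB(5) by (metis inj_onD)
  qed
  moreover have "finite {Z\<in>Pow V. Q Z \<noteq> ?g Z}"
    using V by simp
  ultimately have "card ?C \<le> card {Z\<in>Pow V. Q Z \<noteq> ?g Z}"
    by (metis card_inj_on_le)
  then have "real (card ?C) \<le> hamming V Q ?g"
    using V by (simp add: hamming_def Int_def)
  with Q(2) neg_boundary_class_indicator_le[OF V, of f \<phi> ?C] show ?thesis
    by simp
qed

text \<open>Disjoint spans mean that no point is charged for two classes, so the constant survives
  the summation.\<close>

lemma card_optimal_matching_le:
  assumes V: "finite V" and opt: "optimal_matching V f A B \<phi>"
  shows "real (card A) \<le> 28 * (\<Sum>X\<in>Pow V. sqrt (viol V f X))"
proof -
  have fin: "finite A"
    using matching_finite[OF V] opt unfolding optimal_matching_def by blast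
  define \<C> where "\<C> = match_class A \<phi> ` A"
  have "A = \<Union>\<C>"
    by (auto simp: \<C>_def match_class_def)
  then have "real (card A) \<le> (\<Sum>C\<in>\<C>. real (card C))"
    using card_Union_le_sum_card[of \<C>] by (metis of_nat_le_iff of_nat_sum)
  also have "\<dots> \<le> (\<Sum>C\<in>\<C>. 28 * (\<Sum>X\<in>Pow V \<inter> class_span \<phi> C. sqrt (viol V f X)))"
    using card_match_class_le[OF V opt] by (intro sum_mono) (auto simp: \<C>_def)
  also have "\<dots> = 28 * (\<Sum>X\<in>(\<Union>C\<in>\<C>. Pow V \<inter> class_span \<phi> C). sqrt (viol V f X))"
    unfolding sum_distrib_left[symmetric]
    using V fin by (subst sum.UNION_disjoint) (auto simp: \<C>_def dest: class_span_disjoint)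
  also have "\<dots> \<le> 28 * (\<Sum>X\<in>Pow V. sqrt (viol V f X))"
    using V by (intro mult_left_mono sum_mono2) auto
  finally show ?thesis .
qed

section \<open>From the matching to a nearby monotone function\<close>

lemma monotone_extension:
  fixes f :: "'a set \<Rightarrow> real"
  assumes V: "finite V" and U: "U \<subseteq> Pow V" and mono: "\<And>X Y. X \<in> U \<Longrightarrow> Y \<in> U \<Longrightarrow> X \<subseteq> Y \<Longrightarrow> f X \<le> f Y"
  obtains g where "\<And>X Y. X \<subseteq> Y \<Longrightarrow> g X \<le> g Y" "\<And>X. X \<in> U \<Longrightarrow> g X = f X"
proof
  \<comment> \<open>Default for points with no element of \<open>U\<close> below them; as a lower
    bound of \<open>f\<close> it does not disturb the values on \<open>U\<close>.\<close>
  define c where "c = Min (f ` Pow V)"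
  define g where "g = (\<lambda>X. Max (insert c (f ` {Y\<in>U. Y \<subseteq> X})))"
  have fin: "finite U"
    using U V by (simp add: finite_subset)
  show "g X \<le> g Y" if "X \<subseteq> Y" for X Y
    unfolding g_def using that fin by (intro Max_mono) auto
  show "g X = f X" if "X \<in> U" for X
    unfolding g_def
  proof (rule Max_eqI)
    fix y assume "y \<in> insert c (f ` {Y\<in>U. Y \<subseteq> X})"
    moreover have "c \<le> f X"
      unfolding c_def using that U V by (intro Min_le) auto
    ultimately show "y \<le> f X"
      using that mono by auto
  qed (use fin that in auto)
qed

text \<open>Only matched points are altered, and \<open>A\<close> and \<open>B\<close> are
  equinumerous: 56 = 2 * 28.\<close>

theorem exists_mono_card_neq_le:
  fixes f :: "'a set \<Rightarrow> real"
  assumes V: "finite V"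
  obtains g where "\<And>X Y. X \<subseteq> Y \<Longrightarrow> g X \<le> g Y"
    "real (card {X\<in>Pow V. f X \<noteq> g X}) \<le> 56 * (\<Sum>X\<in>Pow V. sqrt (viol V f X))"
proof -
  obtain A B \<phi> where opt: "optimal_matching V f A B \<phi>"
    using exists_optimal_matching[OF V] .
  then have m: "matching V A B \<phi>"
    by (simp add: optimal_matching_def)
  note fin = matching_finite[OF V m]
  obtain g where g: "\<And>X Y. X \<subseteq> Y \<Longrightarrow> g X \<le> g Y" "\<And>X. X \<in> Pow V - (A \<union> B) \<Longrightarrow> g X = f X"
    using monotone_extension[OF V, of "Pow V - (A \<union> B)" f] optimal_matching_covers[OF V opt] by blast
  have "{X\<in>Pow V. f X \<noteq> g X} \<subseteq> A \<union> B"
  proof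
    fix X assume "X \<in> {X\<in>Pow V. f X \<noteq> g X}"
    then have "X \<in> Pow V" "g X \<noteq> f X"
      by auto
    with g(2)[of X] show "X \<in> A \<union> B"
      by blast
  qed
  then have "card {X\<in>Pow V. f X \<noteq> g X} \<le> card (A \<union> B)"
    using fin by (intro card_mono) auto
  also have "\<dots> \<le> card A + card B"
    by (rule card_Un_le)
  also have "card B = card A"
    using m by (auto simp: matching_def dest: bij_betw_same_card)
  finally have "real (card {X\<in>Pow V. f X \<noteq> g X}) \<le> 2 * real (card A)"
    by simp
  with card_optimal_matching_le[OF V opt] g(1) show ?thesis
    by (intro that[of g]) auto
qed

section \<open>Transfer to extensional functions\<close>

text \<open>The restriction supplies the value \<open>undefined\<close> off \<open>{1..d}\<close>
  that membership in \<open>cube d\<close> requires.\<close>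

definition cube_point :: "nat \<Rightarrow> nat set \<Rightarrow> nat \<Rightarrow> nat" where
  "cube_point d X = (\<lambda>i\<in>{1..d}. if i \<in> X then 1 else 0)"

lemma cube_point_eq_iff:
  assumes "i \<in> {1..d}"
  shows "cube_point d X i = 1 \<longleftrightarrow> i \<in> X" "cube_point d X i = 0 \<longleftrightarrow> i \<notin> X"
    "cube_point d X i = cube_point d Y i \<longleftrightarrow> (i \<in> X \<longleftrightarrow> i \<in> Y)"
  using assms by (simp_all add: cube_point_def)

lemma cube_point_support:
  assumes "X \<subseteq> {1..d}"
  shows "{i\<in>{1..d}. cube_point d X i = 1} = X"
  using assms by (auto simp: cube_point_def)

lemma cube_point_of_support:
  assumes "x \<in> cube d"
  shows "cube_point d {i\<in>{1..d}. x i = 1} = x"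
proof
  fix i
  show "cube_point d {i\<in>{1..d}. x i = 1} i = x i"
  proof (cases "i \<in> {1..d}")
    case True
    then have "x i \<in> {0, 1}"
      using assms by (auto simp: cube_def)
    with True show ?thesis
      by (auto simp: cube_point_def)
  next
    case False
    with assms have "x i = undefined"
      unfolding cube_def by (rule PiE_arb)
    then show ?thesis
      by (simp only: cube_point_def restrict_apply False if_False)
  qed
qed

lemma cube_point_in_cube: "cube_point d X \<in> cube d"
  by (auto simp: cube_point_def cube_def)

lemma bij_betw_cube_point: "bij_betw (cube_point d) (Pow {1..d}) (cube d)"
  by (rule bij_betw_byWitness[where f' = "\<lambda>x. {i\<in>{1..d}. x i = 1}"])
    (use cube_point_support cube_point_of_support cube_point_in_cube in auto)

lemma cube_edges_cube_point_iff:
  assumes X: "X \<subseteq> {1..d}" and Y: "Y \<subseteq> {1..d}"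
  shows "(cube_point d X, cube_point d Y) \<in> cube_edges d \<longleftrightarrow> (\<exists>j\<in>{1..d} - X. Y = insert j X)"
proof
  assume "(cube_point d X, cube_point d Y) \<in> cube_edges d"
  then have "\<exists>!i. i \<in> {1..d} \<and> cube_point d X i = 0 \<and> cube_point d Y i = 1 \<and>
      (\<forall>j\<in>{1..d}. j \<noteq> i \<longrightarrow> cube_point d X j = cube_point d Y j)"
    by (simp only: cube_edges_def mem_Collect_eq case_prod_conv)
  then obtain i where i: "i \<in> {1..d}" "cube_point d X i = 0" "cube_point d Y i = 1"
    and eq: "\<And>j. j \<in> {1..d} \<Longrightarrow> j \<noteq> i \<Longrightarrow> cube_point d X j = cube_point d Y j"
    by (elim ex1E conjE) blast
  have "i \<notin> X" "i \<in> Y"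
    using i cube_point_eq_iff[OF i(1)] by blast+
  moreover have "j \<in> X \<longleftrightarrow> j \<in> Y" if "j \<noteq> i" for j
  proof (cases "j \<in> {1..d}")
    case True
    with eq[OF True that] cube_point_eq_iff(3)[OF True] show ?thesis
      by blast
  next
    case False
    with X Y show ?thesis
      by auto
  qed
  ultimately have "Y = insert i X"
    by (intro set_eqI) (metis insert_iff)
  with i(1) \<open>i \<notin> X\<close> show "\<exists>j\<in>{1..d} - X. Y = insert j X"
    by blast
next
  assume "\<exists>j\<in>{1..d} - X. Y = insert j X"
  then obtain j where j: "j \<in> {1..d}" "j \<notin> X" "Y = insert j X"
    by auto
  have "\<exists>!i. i \<in> {1..d} \<and> cube_point d X i = 0 \<and> cube_point d Y i = 1 \<and>
      (\<forall>k\<in>{1..d}. k \<noteq> i \<longrightarrow> cube_point d X k = cube_point d Y k)"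
  proof (rule ex1I[of _ j])
    show "j \<in> {1..d} \<and> cube_point d X j = 0 \<and> cube_point d Y j = 1 \<and>
      (\<forall>k\<in>{1..d}. k \<noteq> j \<longrightarrow> cube_point d X k = cube_point d Y k)"
      using j cube_point_eq_iff by auto
  next
    fix i assume "i \<in> {1..d} \<and> cube_point d X i = 0 \<and> cube_point d Y i = 1 \<and>
      (\<forall>k\<in>{1..d}. k \<noteq> i \<longrightarrow> cube_point d X k = cube_point d Y k)"
    then have "i \<in> {1..d}" "cube_point d X i = 0" "cube_point d Y i = 1"
      by blast+
    then have "i \<in> Y" "i \<notin> X"
      using cube_point_eq_iff by blast+
    with j show "i = j"
      by simp
  qed
  then show "(cube_point d X, cube_point d Y) \<in> cube_edges d"
    unfolding cube_edges_def by (simp add: cube_point_in_cube)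
qed

lemma neg_influence_cube_point:
  assumes X: "X \<subseteq> {1..d}"
  shows "neg_influence d f (cube_point d X) = viol {1..d} (\<lambda>Z. f (cube_point d Z)) X"
proof -
  let ?J = "{j\<in>{1..d}. f (cube_point d (insert j X)) < f (cube_point d X)}"
  have J: "j \<notin> X" if "j \<in> ?J" for j
    using that by (auto simp: insert_absorb)
  have "{y. (cube_point d X, y) \<in> violated_edges d f} = (\<lambda>j. cube_point d (insert j X)) ` ?J"
  proof (intro equalityI subsetI)
    fix y assume "y \<in> {y. (cube_point d X, y) \<in> violated_edges d f}"
    then have y: "(cube_point d X, y) \<in> cube_edges d" "f y < f (cube_point d X)"
      by (auto simp: violated_edges_def)
    then have "y \<in> cube d"
      by (simp add: cube_edges_def)
    then obtain Y where Y: "Y \<subseteq> {1..d}" "y = cube_point d Y"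
      using bij_betw_cube_point[of d] by (auto simp: bij_betw_def)
    from y(1) obtain j where "j \<in> {1..d}" "Y = insert j X"
      unfolding Y(2) cube_edges_cube_point_iff[OF X Y(1)] by blast
    with y(2) Y(2) show "y \<in> (\<lambda>j. cube_point d (insert j X)) ` ?J"
      by (intro image_eqI[of _ _ j]) simp_all
  next
    fix y assume "y \<in> (\<lambda>j. cube_point d (insert j X)) ` ?J"
    then obtain j where j: "j \<in> ?J" "y = cube_point d (insert j X)"
      by auto
    then have "insert j X \<subseteq> {1..d}" "j \<in> {1..d} - X"
      using J X by auto
    then have "(cube_point d X, y) \<in> cube_edges d"
      unfolding j(2) using cube_edges_cube_point_iff[OF X] by blast
    then show "y \<in> {y. (cube_point d X, y) \<in> violated_edges d f}"
      using j by (simp add: violated_edges_def)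
  qed
  moreover have "inj_on (\<lambda>j. cube_point d (insert j X)) ?J"
  proof (rule inj_onI)
    fix i j assume ij: "i \<in> ?J" "j \<in> ?J" and eq: "cube_point d (insert i X) = cube_point d (insert j X)"
    have "insert i X = insert j X"
      using inj_onD[OF bij_betw_imp_inj_on[OF bij_betw_cube_point] eq] ij X by auto
    with J ij show "i = j"
      by blast
  qed
  ultimately show ?thesis
    unfolding neg_influence_def viol_def by (simp add: card_image)
qed

theorem theorem1p1:
  "\<exists>C::real. C > 0 \<and>
     (\<forall>d\<ge>1. \<forall>f :: (nat \<Rightarrow> nat) \<Rightarrow> real.
        measure_pmf.expectation (unif_cube d) (\<lambda>x. sqrt (real (neg_influence d f x)))
          \<ge> C * dist_mono d f)"
\<comment> \<open>Reciprocal of the constant in \<open>exists_mono_card_neq_le\<close>.\<close>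
proof (intro exI[of _ "1 / 56"] conjI allI impI)
  fix d :: nat and f :: "(nat \<Rightarrow> nat) \<Rightarrow> real"
  let ?V = "{1..d}" and ?F = "\<lambda>X. f (cube_point d X)"
  obtain g where mono: "\<And>X Y. X \<subseteq> Y \<Longrightarrow> g X \<le> g Y"
    and card: "real (card {X\<in>Pow ?V. ?F X \<noteq> g X}) \<le> 56 * (\<Sum>X\<in>Pow ?V. sqrt (viol ?V ?F X))"
    using exists_mono_card_neq_le[of ?V ?F] by auto
  define G where "G = (\<lambda>x :: nat \<Rightarrow> nat. g {i\<in>?V. x i = 1})"
  have "cube_monotone d G"
    unfolding cube_monotone_def
  proof (rule monotone_onI)
    fix x y assume xy: "x \<in> cube d" "y \<in> cube d" "cube_le d x y"
    have "y i = 1" if "i \<in> ?V" "x i = 1" for i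
    proof -
      have "y i \<in> {0, 1}"
        using xy(2) that(1) unfolding cube_def by (rule PiE_mem)
      moreover have "x i \<le> y i"
        using xy(3) that(1) by (simp add: cube_le_def)
      ultimately show ?thesis
        using that(2) by auto
    qed
    then show "G x \<le> G y"
      unfolding G_def by (intro mono) auto
  qed
  then have "dist_mono d f \<le> measure_pmf.prob (unif_cube d) {x. f x \<noteq> G x}"
    by (rule dist_mono_le)
  also have "\<dots> = real (card (cube d \<inter> {x. f x \<noteq> G x})) / real (card (cube d))"
    by (simp add: unif_cube_def measure_pmf_of_set[OF cube_nonempty finite_cube])
  also have "cube d \<inter> {x. f x \<noteq> G x} = cube_point d ` {X\<in>Pow ?V. ?F X \<noteq> g X}"
  proof -
    have G: "G (cube_point d X) = g X" if "X \<in> Pow ?V" for X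
      using that unfolding G_def by (simp only: cube_point_support Pow_iff)
    have "cube d \<inter> {x. f x \<noteq> G x} = cube_point d ` {X\<in>Pow ?V. ?F X \<noteq> G (cube_point d X)}"
      unfolding bij_betw_imp_surj_on[OF bij_betw_cube_point[of d], symmetric] by blast
    also have "{X\<in>Pow ?V. ?F X \<noteq> G (cube_point d X)} = {X\<in>Pow ?V. ?F X \<noteq> g X}"
      by (intro Collect_cong conj_cong refl) (simp only: G)
    finally show ?thesis .
  qed
  also have "card \<dots> = card {X\<in>Pow ?V. ?F X \<noteq> g X}"
    by (intro card_image inj_on_subset[OF bij_betw_imp_inj_on[OF bij_betw_cube_point[of d]]]) auto
  also have "real (card {X\<in>Pow ?V. ?F X \<noteq> g X}) / real (card (cube d)) \<le>
      56 * (\<Sum>X\<in>Pow ?V. sqrt (viol ?V ?F X)) / real (card (cube d))"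
    using card by (rule divide_right_mono) simp
  finally have "1 / 56 * dist_mono d f \<le> (\<Sum>X\<in>Pow ?V. sqrt (viol ?V ?F X)) / real (card (cube d))"
    by linarith
  also have "(\<Sum>X\<in>Pow ?V. sqrt (viol ?V ?F X)) = (\<Sum>X\<in>Pow ?V. sqrt (neg_influence d f (cube_point d X)))"
    by (intro sum.cong refl) (simp add: neg_influence_cube_point)
  also have "\<dots> = (\<Sum>x\<in>cube d. sqrt (neg_influence d f x))"
    by (rule sum.reindex_bij_betw[OF bij_betw_cube_point])
  also have "\<dots> / real (card (cube d)) =
      measure_pmf.expectation (unif_cube d) (\<lambda>x. sqrt (real (neg_influence d f x)))"
    unfolding unif_cube_def by (rule integral_pmf_of_set[OF cube_nonempty finite_cube, symmetric])
  finally show "1 / 56 * dist_mono d f \<le>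
      measure_pmf.expectation (unif_cube d) (\<lambda>x. sqrt (real (neg_influence d f x)))" .
qed simp

end
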